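(* Consider the system with state $x=(x_1,\dots,x_n)\in\mathbb{R}^n$ and output $y\in\mathbb{R}$ $$\dot x_i=f_i(t,x_1,\dots,x_i)+a_i(t,x_1)\,x_{i+1}^{m_i},\quad i=1,\dots,n-1,\qquad \dot x_n=f_n(t,x_1,\dots,x_n),\qquad y=x_1, \tag{$\ast$}$$ where $m_1,\dots,m_{n-1}$ are odd positive integers, $f_i\in C^1(\mathbb{R}_{\ge 0}\times\mathbb{R}^i;\mathbb{R})$ for $i=1,\dots,n$, and $a_i\in C^1(\mathbb{R}_{\ge 0}\times\mathbb{R};\mathbb{R})$ for $i=1,\dots,n-1$. Assume that $(\ast)$ is forward complete; particularly, that there is $\beta\in NN$ such that the solution $x(\cdot)=x(\cdot,t_0,x_0)$ of $(\ast)$ with $x(t_0)=x_0$ satisfies $$|x(t)|\le \beta(t,|x_0|)\quad\text{for all } t\ge t_0\ge 0,\ x_0\in\mathbb{R}^n .$$ Assume moreover that $|a_i(t,y)|>0$ for all $t\ge 0$, $y\in\mathbb{R}$, $i=1,\dots,n-1$. Then: (i) the Switching Observer Design Problem (SODP) is solvable for $(\ast)$ with respect to $\mathbb{R}^n$; (ii) if in addition it is a priori known that the initial states of $(\ast)$ belong to a given ball $B_R$, $R>0$, then the Observer Design Problem (ODP) is solvable for $(\ast)$ with respect to $B_R$.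
   Context: Notation: $|\cdot|$ is the Euclidean norm; $B_R$ is the closed ball of radius $R$ centered at $0\in\mathbb{R}^n$; $\mathbb{N}=\{1,2,\dots\}$. $N$ is the class of all increasing continuous functions $\phi:\mathbb{R}_{\ge0}\to\mathbb{R}_{\ge0}$, and $NN$ is the class of continuous functions $\beta:\mathbb{R}_{\ge0}\times\mathbb{R}_{\ge0}\to\mathbb{R}_{\ge0}$ such that $\beta(\cdot,s)\in N$ and $\beta(t,\cdot)\in N$ for all fixed $s,t\ge0$. Consider a general system $\dot x=f(t,x)$, $y=h(t,x)$, $(t,x)\in\mathbb{R}_{\ge0}\times\mathbb{R}^n$, $y\in\mathbb{R}^{\bar n}$, with $f$ continuous and locally Lipschitz in $x$, forward complete; $x(\cdot,t_0,x_0)$ denotes the solution with $x(t_0)=x_0$. For $t_0\ge0$ and $\emptyset\ne M\subset\mathbb{R}^n$ let $$O(t_0,M)=\{y:[t_0,\infty)\to\mathbb{R}^{\bar n}:\ y(t)=h(t,x(t,t_0,x_0)),\ x_0\in M\}.$$ ODP. The Observer Design Problem is solvable for the system with respect to $M$ if for every $t_0\ge0$ there exist a continuous map $G=G_{t_0}(t,z,w):[t_0,\infty)\times\mathbb{R}^n\times\mathbb{R}^{\bar n}\to\mathbb{R}^n$ and a nonempty set $\bar M\subset\mathbb{R}^n$ such that for every $z_0\in\bar M$ and every output $y\in O(t_0,M)$, with $y$ generated by $x(\cdot)=x(\cdot,t_0,x_0)$, $x_0\in M$, the trajectory $z(\cdot)$ of $\dot z=G(t,z,y(t))$, $z(t_0)=z_0$,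 exists for all $t\ge t_0$ and $\lim_{t\to\infty}(x(t)-z(t))=0$. SODP. The Switching Observer Design Problem is solvable for the system with respect to $M$ if for every $t_0\ge0$ there exist a strictly increasing sequence of times $(t_k)_{k\in\mathbb{N}}$ with $t_1=t_0$ and $\lim_{k\to\infty}t_k=\infty$, a sequence of continuous maps $G_k=G_{k,t_{k-1}}(t,z,w):[t_{k-1},t_{k+1}]\times\mathbb{R}^n\times\mathbb{R}^{\bar n}\to\mathbb{R}^n$, $k\in\mathbb{N}$, and a nonempty set $\bar M\subset\mathbb{R}^n$ such that, for every output $y\in O(t_0,M)$ generated by $x(\cdot)=x(\cdot,t_0,x_0)$, $x_0\in M$, the solution $z_k(\cdot)$ of $\dot z_k=G_k(t,z_k,y(t))$, $t\in[t_{k-1},t_{k+1}]$, with initial value $z_k(t_{k-1})\in\bar M$ is defined for all $t\in[t_{k-1},t_{k+1}]$, and the piecewise continuous map $Z:[t_0,\infty)\to\mathbb{R}^n$ given by $Z(t)=z_k(t)$ for $t\in[t_k,t_{k+1})$, $k\in\mathbb{N}$, satisfies $\lim_{t\to\infty}(x(t)-Z(t))=0$. *)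

theory Defs
  imports "HOL-Analysis.Analysis"
begin

definition class_N :: "(real \<Rightarrow> real) \<Rightarrow> bool" where
  "class_N \<phi> \<longleftrightarrow> continuous_on {0..} \<phi> \<and> mono_on {0..} \<phi> \<and> (\<forall>s\<ge>0. 0 \<le> \<phi> s)"

definition class_NN :: "(real \<Rightarrow> real \<Rightarrow> real) \<Rightarrow> bool" where
  "class_NN \<beta> \<longleftrightarrow>
     continuous_on ({0..} \<times> {0..}) (\<lambda>(t, s). \<beta> t s) \<and>
     (\<forall>s\<ge>0. class_N (\<lambda>t. \<beta> t s)) \<and>
     (\<forall>t\<ge>0. class_N (\<lambda>s. \<beta> t s))"

text \<open>Continuous differentiability on a set. At boundary points the derivative is taken relative
  to the set; on a set such as \<open>{0..} \<times> UNIV\<close> it is still uniquely determined.\<close>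

definition C1_on :: "'a::euclidean_space set \<Rightarrow> ('a \<Rightarrow> 'b::euclidean_space) \<Rightarrow> bool" where
  "C1_on S g \<longleftrightarrow>
     (\<exists>g' :: 'a \<Rightarrow> 'a \<Rightarrow>\<^sub>L 'b.
        (\<forall>p\<in>S. (g has_derivative blinfun_apply (g' p)) (at p within S)) \<and> continuous_on S g')"

text \<open>Used only for nondegenerate intervals \<open>J\<close>; derivatives at endpoints are one-sided.\<close>

definition is_solution ::
    "(real \<Rightarrow> 'a::real_normed_vector \<Rightarrow> 'a) \<Rightarrow> real set \<Rightarrow> (real \<Rightarrow> 'a) \<Rightarrow> bool" where
  "is_solution F J x \<longleftrightarrow> (\<forall>t\<in>J. (x has_vector_derivative F t (x t)) (at t within J))"

text \<open>``The solution with value \<open>x0\<close> at time \<open>s\<close> exists on all of \<open>J\<close>'', where \<open>J\<close> is an interval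
  with least element \<open>s\<close>. Since the right-hand side of an observer is only required to be
  continuous, uniqueness is not built in: the condition is that there is a solution on \<open>J\<close> and that
  every solution on an initial subinterval continues to one on \<open>J\<close>.\<close>

definition solution_exists_on ::
    "(real \<Rightarrow> 'a::real_normed_vector \<Rightarrow> 'a) \<Rightarrow> real set \<Rightarrow> real \<Rightarrow> 'a \<Rightarrow> bool" where
  "solution_exists_on F J s x0 \<longleftrightarrow>
     (\<exists>x. is_solution F J x \<and> x s = x0) \<and>
     (\<forall>T x. s < T \<and> {s..<T} \<subseteq> J \<and> is_solution F {s..<T} x \<and> x s = x0 \<longrightarrow>
        (\<exists>x'. is_solution F J x' \<and> (\<forall>t\<in>{s..<T}. x' t = x t)))"

definition forward_complete :: "(real \<Rightarrow> 'a::real_normed_vector \<Rightarrow> 'a) \<Rightarrow> bool" where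
  "forward_complete F \<longleftrightarrow> (\<forall>t0\<ge>0. \<forall>x0. solution_exists_on F {t0..} t0 x0)"

text \<open>In the next two definitions the system is \<open>x' = F t x\<close> with output \<open>y = h t x\<close>. Quantifying
  over the trajectories \<open>x\<close> starting in \<open>M\<close> at time \<open>t0\<close> amounts to quantifying over the outputs in
  \<open>O(t0, M)\<close> together with the trajectories generating them.\<close>

definition ODP_solvable ::
    "(real \<Rightarrow> 'a::euclidean_space \<Rightarrow> 'a) \<Rightarrow> (real \<Rightarrow> 'a \<Rightarrow> 'b::euclidean_space) \<Rightarrow> 'a set \<Rightarrow> bool" where
  "ODP_solvable F h M \<longleftrightarrow>
     (\<forall>t0\<ge>0. \<exists>(G :: real \<Rightarrow> 'a \<Rightarrow> 'b \<Rightarrow> 'a) Mbar.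
        continuous_on ({t0..} \<times> UNIV \<times> UNIV) (\<lambda>(t, z, w). G t z w) \<and>
        Mbar \<noteq> {} \<and>
        (\<forall>z0\<in>Mbar. \<forall>x. is_solution F {t0..} x \<and> x t0 \<in> M \<longrightarrow>
           solution_exists_on (\<lambda>t z. G t z (h t (x t))) {t0..} t0 z0 \<and>
           (\<forall>z. is_solution (\<lambda>t z. G t z (h t (x t))) {t0..} z \<and> z t0 = z0 \<longrightarrow>
              ((\<lambda>t. x t - z t) \<longlongrightarrow> 0) at_top)))"

text \<open>The switching times are \<open>\<tau> 1 < \<tau> 2 < \<dots>\<close>; \<open>\<tau> 0 = \<tau> 1 = t0\<close>, so that the first observer acts
  on \<open>{\<tau> 0..\<tau> 2}\<close>. The initial values of the observers are chosen in \<open>Mbar\<close> independently for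
  each \<open>k\<close>.\<close>

definition SODP_solvable ::
    "(real \<Rightarrow> 'a::euclidean_space \<Rightarrow> 'a) \<Rightarrow> (real \<Rightarrow> 'a \<Rightarrow> 'b::euclidean_space) \<Rightarrow> 'a set \<Rightarrow> bool" where
  "SODP_solvable F h M \<longleftrightarrow>
     (\<forall>t0\<ge>0. \<exists>(\<tau> :: nat \<Rightarrow> real) (G :: nat \<Rightarrow> real \<Rightarrow> 'a \<Rightarrow> 'b \<Rightarrow> 'a) Mbar.
        \<tau> 0 = t0 \<and> \<tau> 1 = t0 \<and> strict_mono_on {1..} \<tau> \<and> filterlim \<tau> at_top sequentially \<and>
        (\<forall>k\<ge>1. continuous_on ({\<tau> (k - 1)..\<tau> (k + 1)} \<times> UNIV \<times> UNIV) (\<lambda>(t, z, w). G k t z w)) \<and>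
        Mbar \<noteq> {} \<and>
        (\<forall>x. is_solution F {t0..} x \<and> x t0 \<in> M \<longrightarrow>
           (\<forall>k\<ge>1. \<forall>z0\<in>Mbar.
              solution_exists_on (\<lambda>t z. G k t z (h t (x t))) {\<tau> (k - 1)..\<tau> (k + 1)} (\<tau> (k - 1)) z0) \<and>
           (\<forall>z Z.
              (\<forall>k\<ge>1. is_solution (\<lambda>t z. G k t z (h t (x t))) {\<tau> (k - 1)..\<tau> (k + 1)} (z k) \<and>
                 z k (\<tau> (k - 1)) \<in> Mbar) \<and>
              (\<forall>k\<ge>1. \<forall>t\<in>{\<tau> k..<\<tau> (k + 1)}. Z t = z k t) \<longrightarrow>
              ((\<lambda>t. x t - Z t) \<longlongrightarrow> 0) at_top)))"

text \<open>The enumeration \<open>e\<close> of the index type, a bijection from \<open>{1..CARD('n)}\<close>, numbers the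
  coordinates: \<open>x\<^sub>i\<close> is \<open>x $ e i\<close>. The \<open>e i\<close>-component of the field is the \<open>i\<close>-th summand.\<close>

definition triangular_field ::
    "(nat \<Rightarrow> 'n::finite) \<Rightarrow> (nat \<Rightarrow> real \<Rightarrow> real^'n \<Rightarrow> real) \<Rightarrow> (nat \<Rightarrow> real \<Rightarrow> real \<Rightarrow> real) \<Rightarrow>
     (nat \<Rightarrow> nat) \<Rightarrow> real \<Rightarrow> real^'n \<Rightarrow> real^'n" where
  "triangular_field e f a m t x =
     (\<Sum>i=1..CARD('n).
        axis (e i) (f i t x + (if i < CARD('n) then a i t (x $ e 1) * (x $ e (i + 1)) ^ m i else 0)))"

text \<open>A function of \<open>(t, x\<^sub>1, \<dots>, x\<^sub>i)\<close> is represented as a function of \<open>(t, x)\<close> which does not depend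
  on the remaining coordinates of \<open>x\<close>.\<close>

definition depends_on_first ::
    "(nat \<Rightarrow> 'n::finite) \<Rightarrow> nat \<Rightarrow> (real \<Rightarrow> real^'n \<Rightarrow> real) \<Rightarrow> bool" where
  "depends_on_first e i g \<longleftrightarrow>
     (\<forall>t\<ge>0. \<forall>x x'. (\<forall>j\<in>{1..i}. x $ e j = x' $ e j) \<longrightarrow> g t x = g t x')"

end

theory Submission
  imports Defs "HOL-Real_Asymp.Real_Asymp"
begin

text \<open>Along a trajectory the output determines the state: \<open>x\<^sub>i\<^sub>+\<^sub>1\<close> is the \<open>m\<^sub>i\<close>-th root of
  \<open>(x\<^sub>i' - f\<^sub>i(t, x\<^sub>1, \<dots>, x\<^sub>i)) / a\<^sub>i(t, x\<^sub>1)\<close>, because \<open>m\<^sub>i\<close> is odd and \<open>a\<^sub>i\<close> has no zero. The observer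
  imitates this recursion. Starting from the exact value \<open>X\<^sub>1 = y\<close>, it runs for each \<open>i\<close> the scalar
  filter \<open>z\<^sub>i' = (K\<^sub>i + K\<^sub>i'/K\<^sub>i) (X\<^sub>i - z\<^sub>i)\<close> with a time-varying gain \<open>K\<^sub>i\<close>, takes \<open>K\<^sub>i (X\<^sub>i - z\<^sub>i)\<close> as a
  substitute for \<open>x\<^sub>i'\<close>, and obtains the next estimate \<open>X\<^sub>i\<^sub>+\<^sub>1\<close> by the formula above (\<open>estimate\<close>,
  \<open>observer\<close>). The right-hand side is only continuous, since roots are not Lipschitz at 0. But \<open>X\<^sub>i\<close>
  depends on \<open>y\<close> and \<open>z\<^sub>1, \<dots>, z\<^sub>i\<^sub>-\<^sub>1\<close> alone, so the observer is a cascade of scalar linear equations,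
  and its solutions are global and unique (\<open>observer_solution\<close>, \<open>observer_unique\<close>).

  For a filter with gain \<open>K\<close>, state \<open>z\<close> and input \<open>X\<close> near \<open>x\<close>, the quantity \<open>v = K (z - x) + x'\<close> satisfies
  \<open>v' = - K v + (K\<^sup>2 + K') (X - x) + x''\<close>. So \<open>v\<close> tends to 0 if \<open>K\<close> dominates \<open>x''\<close> and \<open>X - x\<close> is small
  even after multiplication by \<open>K\<^sup>2 + K'\<close>; then \<open>K (X - z)\<close> approaches \<open>x'\<close> (\<open>high_gain_tracking\<close>).
  Taking the root turns an error \<open>\<delta>\<close> into an error of order \<open>\<delta>\<close> to the power \<open>1/m\<^sub>i\<close>
  (\<open>odd_root_hoelder\<close>), which the next filter multiplies by its own, larger factor. The gains are
  therefore chosen from the last filter to the first, each one large enough for its successors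
  (\<open>gain_sequence\<close>).

  The gains have to dominate the first and second derivatives of \<open>x\<close>, Lipschitz constants of \<open>f\<^sub>i\<close> and the
  values \<open>1/a\<^sub>i\<close> along the trajectories. If \<open>\<bar>x(t\<^sub>0)\<bar> \<le> R\<close>, then \<open>\<bar>x(t)\<bar> \<le> \<beta>(t, R) \<le> \<beta>(t, t)\<close> as soon
  as \<open>t \<ge> R\<close>; hence bounds over the balls of radius \<open>\<beta>(t, t) + 1\<close> eventually apply to every trajectory
  (\<open>system_majorant\<close>), and one observer works for all initial values. This solves the Observer Design
  Problem.

  Moreover the convergence is uniform over all trajectories with \<open>\<bar>x(t\<^sub>0)\<bar> \<le> R\<close> when the observer
  starts at 0 at a given time (\<open>observed_uniform_convergence\<close>). For the Switching Observer Design
  Problem the same observer is restarted at 0 at each switching time, and the next switching time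
  is chosen so late that the restarted copy has error below \<open>1/k\<close> for all trajectories with
  \<open>\<bar>x(t\<^sub>0)\<bar> \<le> k\<close>.\<close>

section \<open>Scalar linear equations\<close>

lemma antiderivative_on_ray:
  fixes g :: "real \<Rightarrow> real"
  assumes "continuous_on {s..} g"
  obtains P where "P s = 0" "\<And>t. s \<le> t \<Longrightarrow> (P has_real_derivative g t) (at t within {s..})"
proof (rule that[of "\<lambda>r. integral {s..r} g"])
  show "integral {s..s} g = 0"
    by simp
  fix t assume t: "s \<le> t"
  have "((\<lambda>r. integral {s..r} g) has_real_derivative g t) (at t within {s..t+1})"
    using t by (intro integral_has_real_derivative continuous_on_subset[OF assms]) auto
  moreover have "at t within {s..t+1} = at t within {s..}"
    by (rule at_within_nhd[of _ "{..<t+1}"]) auto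
  ultimately show "((\<lambda>r. integral {s..r} g) has_real_derivative g t) (at t within {s..})"
    by simp
qed

lemma linear_ode_solution:
  fixes c u :: "real \<Rightarrow> real"
  assumes c: "continuous_on {s..} c" and u: "continuous_on {s..} u"
  obtains z where "z s = z0"
    "\<And>t. s \<le> t \<Longrightarrow> (z has_real_derivative c t * (u t - z t)) (at t within {s..})"
proof -
  obtain P where P0: "P s = 0"
    and P: "\<And>t. s \<le> t \<Longrightarrow> (P has_real_derivative c t) (at t within {s..})"
    using antiderivative_on_ray[OF c] by blast
  have "continuous_on {s..} P"
    using P by (intro DERIV_continuous_on) auto
  then have "continuous_on {s..} (\<lambda>t. c t * u t * exp (P t))"
    using c u by (intro continuous_intros)
  from antiderivative_on_ray[OF this] obtain Q where Q0: "Q s = 0" and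
    Q: "\<And>t. s \<le> t \<Longrightarrow> (Q has_real_derivative c t * u t * exp (P t)) (at t within {s..})"
    by blast
  show thesis
  proof
    show "exp (- P s) * (z0 + Q s) = z0"
      by (simp add: P0 Q0)
    fix t assume t: "s \<le> t"
    have e: "exp (- P t) * exp (P t) = 1"
      by (simp flip: exp_add)
    show "((\<lambda>t. exp (- P t) * (z0 + Q t)) has_real_derivative
       c t * (u t - exp (- P t) * (z0 + Q t))) (at t within {s..})"
      by (rule derivative_eq_intros P[OF t] Q[OF t] refl)+
         (use e in \<open>simp add: algebra_simps\<close>)
  qed
qed

lemma linear_ode_unique:
  fixes c u :: "real \<Rightarrow> real"
  assumes c: "continuous_on {s..} c" and b: "s \<le> b"
    and z: "\<And>t. t \<in> {s..b} \<Longrightarrow> (z has_real_derivative c t * (u t - z t)) (at t within {s..b})"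
    and z': "\<And>t. t \<in> {s..b} \<Longrightarrow> (z' has_real_derivative c t * (u t - z' t)) (at t within {s..b})"
    and eq: "z s = z' s"
  shows "z b = z' b"
proof -
  obtain P where P: "\<And>t. s \<le> t \<Longrightarrow> (P has_real_derivative c t) (at t within {s..})"
    using antiderivative_on_ray[OF c] by blast
  have P': "(P has_real_derivative c t) (at t within {s..b})" if "t \<in> {s..b}" for t
    using that by (intro DERIV_subset[OF P]) auto
  have "((\<lambda>t. (z t - z' t) * exp (P t)) has_real_derivative 0) (at t within {s..b})"
    if "t \<in> {s..b}" for t
    by (rule derivative_eq_intros P'[OF that] z[OF that] z'[OF that] refl)+
       (simp add: algebra_simps)
  then have "\<exists>k. \<forall>t\<in>{s..b}. (z t - z' t) * exp (P t) = k"
    by (intro has_field_derivative_zero_constant) auto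
  then have "(z b - z' b) * exp (P b) = (z s - z' s) * exp (P s)"
    using b by auto
  then show ?thesis
    using eq by simp
qed

text \<open>With an antiderivative \<open>P\<close> of \<open>c\<close>, the function \<open>(q - M) exp P\<close> is nonincreasing, and \<open>P\<close> grows at
  least like \<open>t/2\<close>.\<close>

lemma damped_upper_bound:
  fixes c g q :: "real \<Rightarrow> real"
  assumes ab: "a \<le> b" and c: "continuous_on {a..b} c"
    and q: "\<And>t. t \<in> {a..b} \<Longrightarrow> (q has_real_derivative g t - c t * q t) (at t within {a..b})"
    and c_ge: "\<And>t. t \<in> {a..b} \<Longrightarrow> 1/2 \<le> c t"
    and g: "\<And>t. t \<in> {a..b} \<Longrightarrow> g t \<le> c t * M" and M: "0 \<le> M"
  shows "q b \<le> M + exp (- (b - a) / 2) * \<bar>q a\<bar>"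
proof -
  define P where "P t = integral {a..t} c" for t
  have P: "(P has_real_derivative c t) (at t within {a..b})" if "t \<in> {a..b}" for t
    unfolding P_def by (rule integral_has_real_derivative[OF c that])
  have Pa: "P a = 0"
    by (simp add: P_def)
  have "(P a - a/2) \<le> (P b - b/2)"
  proof (rule DERIV_nonneg_imp_increasing_open[OF ab])
    show "continuous_on {a..b} (\<lambda>t. P t - t/2)"
      using P by (intro continuous_intros DERIV_continuous_on) auto
    fix t assume t: "a < t" "t < b"
    have "(P has_real_derivative c t) (at t)"
      using P[of t] t by (simp add: at_within_Icc_at)
    then have "((\<lambda>t. P t - t/2) has_real_derivative c t - 1/2) (at t)"
      by (auto intro!: derivative_eq_intros)
    then show "\<exists>y. ((\<lambda>t. P t - t/2) has_real_derivative y) (at t) \<and> 0 \<le> y"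
      using c_ge[of t] t by auto
  qed
  then have Pb: "(b - a)/2 \<le> P b"
    using Pa by (simp add: field_simps)
  have "(q b - M) * exp (P b) \<le> (q a - M) * exp (P a)"
  proof (rule DERIV_nonpos_imp_decreasing_open[OF ab])
    show "continuous_on {a..b} (\<lambda>t. (q t - M) * exp (P t))"
      using P q by (intro continuous_intros DERIV_continuous_on) auto
    fix t assume t: "a < t" "t < b"
    then have "(P has_real_derivative c t) (at t)" "(q has_real_derivative g t - c t * q t) (at t)"
      using P[of t] q[of t] by (simp_all add: at_within_Icc_at)
    then have "((\<lambda>t. (q t - M) * exp (P t)) has_real_derivative (g t - c t * M) * exp (P t)) (at t)"
      by (auto intro!: derivative_eq_intros simp: algebra_simps)
    moreover have "(g t - c t * M) * exp (P t) \<le> 0"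
      using g[of t] t by (simp add: mult_le_0_iff)
    ultimately show "\<exists>y. ((\<lambda>t. (q t - M) * exp (P t)) has_real_derivative y) (at t) \<and> y \<le> 0"
      by blast
  qed
  then have "(q b - M) * exp (P b) \<le> \<bar>q a\<bar>"
    using Pa M by simp
  then have "q b - M \<le> exp (- P b) * \<bar>q a\<bar>"
    by (simp add: exp_minus field_simps)
  also have "\<dots> \<le> exp (- (b - a)/2) * \<bar>q a\<bar>"
    using Pb by (intro mult_right_mono) auto
  finally show ?thesis
    by simp
qed

lemma damped_bound:
  fixes c g q :: "real \<Rightarrow> real"
  assumes ab: "a \<le> b" and c: "continuous_on {a..b} c"
    and q: "\<And>t. t \<in> {a..b} \<Longrightarrow> (q has_real_derivative g t - c t * q t) (at t within {a..b})"
    and c_ge: "\<And>t. t \<in> {a..b} \<Longrightarrow> 1/2 \<le> c t"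
    and g: "\<And>t. t \<in> {a..b} \<Longrightarrow> \<bar>g t\<bar> \<le> c t * M"
  shows "\<bar>q b\<bar> \<le> M + exp (- (b - a) / 2) * \<bar>q a\<bar>"
proof -
  have "0 \<le> c a * M" "0 < c a"
    using g[of a] c_ge[of a] ab by auto
  then have M: "0 \<le> M"
    by (simp add: zero_le_mult_iff)
  have "q b \<le> M + exp (- (b - a) / 2) * \<bar>q a\<bar>"
    using g by (intro damped_upper_bound[OF ab c q c_ge _ M]) (auto simp: abs_le_iff)
  moreover have "((\<lambda>t. - q t) has_real_derivative - g t - c t * (- q t)) (at t within {a..b})"
    if "t \<in> {a..b}" for t
    using DERIV_minus[OF q[OF that]] by simp
  then have "- q b \<le> M + exp (- (b - a) / 2) * \<bar>- q a\<bar>"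
    using g by (intro damped_upper_bound[where g = "\<lambda>t. - g t", OF ab c _ c_ge _ M])
      (simp_all add: abs_le_iff)
  ultimately show ?thesis
    by (simp add: abs_le_iff)
qed

section \<open>Smooth majorants\<close>

text \<open>A gain is carried together with its derivative, because the derivative enters the right-hand
  side of the observer. Being at least 1, weights can be multiplied and divided by freely in
  estimates.\<close>

definition weight :: "(real \<Rightarrow> real) \<Rightarrow> (real \<Rightarrow> real) \<Rightarrow> bool" where
  "weight W W' \<longleftrightarrow> (\<forall>t. (W has_real_derivative W' t) (at t)) \<and> continuous_on UNIV W' \<and> (\<forall>t. 1 \<le> W t)"

lemma weightD:
  assumes "weight W W'"
  shows "(W has_real_derivative W' t) (at t within S)" "continuous_on S W'" "continuous_on S W"
    "1 \<le> W t" "0 < W t"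
proof -
  show "1 \<le> W t" "continuous_on S W'"
    using assms unfolding weight_def by (auto intro: continuous_on_subset)
  then show "0 < W t"
    by linarith
  show D: "(W has_real_derivative W' t) (at t within S)" for t
    using assms unfolding weight_def by (meson has_field_derivative_at_within)
  show "continuous_on S W"
    by (rule DERIV_continuous_on[OF D])
qed

lemma has_derivative_max_0_square:
  "((\<lambda>t::real. (max 0 t)\<^sup>2) has_real_derivative 2 * max 0 t) (at t)"
proof -
  consider "t < 0" | "t = 0" | "0 < t" by linarith
  then show ?thesis
  proof cases
    case 1
    have "((\<lambda>t::real. 0) has_real_derivative 0) (at t)" by simp
    then have "((\<lambda>t::real. (max 0 t)\<^sup>2) has_real_derivative 0) (at t)"
      by (rule has_field_derivative_transform_within_open[of _ _ _ "{..<0}"]) (use 1 in auto)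
    then show ?thesis using 1 by simp
  next
    case 3
    have "((\<lambda>t::real. t\<^sup>2) has_real_derivative 2 * t) (at t)"
      by (auto intro!: derivative_eq_intros)
    then have "((\<lambda>t::real. (max 0 t)\<^sup>2) has_real_derivative 2 * t) (at t)"
      by (rule has_field_derivative_transform_within_open[of _ _ _ "{0<..}"]) (use 3 in auto)
    then show ?thesis using 3 by simp
  next
    case 2
    have "(max 0 h)\<^sup>2 / h = max 0 h" for h :: real
      by (simp add: max_def power2_eq_square)
    moreover have "((\<lambda>h::real. max 0 h) \<longlongrightarrow> max 0 0) (at 0)"
      by (intro tendsto_intros)
    ultimately show ?thesis
      unfolding 2 by (simp add: has_field_derivative_iff)
  qed
qed

text \<open>If \<open>C (j + 1)\<close> bounds \<open>h\<close> up to time \<open>j + 1\<close>, then the multiple by \<open>\<bar>C (j + 1)\<bar>\<close> of the squared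
  positive part of \<open>t + 1 - j\<close> is at least \<open>h\<close> on \<open>[j, j + 1]\<close> and vanishes before time \<open>j - 1\<close>. Hence the
  sum of these functions over \<open>j\<close> is locally finite, continuously differentiable and a majorant. The
  index \<open>q\<close> allows whole families to be dominated at once.\<close>

lemma weight_majorant:
  fixes D :: "(real \<times> 'q) set" and h :: "real \<Rightarrow> 'q \<Rightarrow> real"
  assumes "\<And>T. \<exists>C. \<forall>(t, q)\<in>D. 0 \<le> t \<and> t \<le> T \<longrightarrow> h t q \<le> C"
  obtains W W' where "weight W W'" "\<And>t q. (t, q) \<in> D \<Longrightarrow> 0 \<le> t \<Longrightarrow> h t q \<le> W t"
proof -
  obtain C where C: "\<And>T t q. (t, q) \<in> D \<Longrightarrow> 0 \<le> t \<Longrightarrow> t \<le> T \<Longrightarrow> h t q \<le> C T"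
    using assms by (metis (no_types, lifting) case_prodD)
  define b where "b j t = \<bar>C (real j + 1)\<bar> * (max 0 (t + 1 - real j))\<^sup>2" for j t
  define b' where "b' j t = \<bar>C (real j + 1)\<bar> * (2 * max 0 (t + 1 - real j))" for j t
  define W where "W t = 1 + (\<Sum>j<nat \<lceil>t + 1\<rceil>. b j t)" for t
  define W' where "W' t = (\<Sum>j<nat \<lceil>t + 1\<rceil>. b' j t)" for t
  have W_eq: "W t = 1 + (\<Sum>j<N. b j t)" and W'_eq: "W' t = (\<Sum>j<N. b' j t)"
    if "t + 1 \<le> real N" for t N
  proof -
    have "(\<Sum>j<N. b j t) = (\<Sum>j<nat \<lceil>t + 1\<rceil>. b j t)" "(\<Sum>j<N. b' j t) = (\<Sum>j<nat \<lceil>t + 1\<rceil>. b' j t)"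
      using that by (auto intro!: sum.mono_neutral_right simp: b_def b'_def) linarith+
    then show "W t = 1 + (\<Sum>j<N. b j t)" "W' t = (\<Sum>j<N. b' j t)"
      by (simp_all add: W_def W'_def)
  qed
  have cont: "continuous_on UNIV (b' j)" for j
    unfolding b'_def by (intro continuous_intros)
  have b: "(b j has_real_derivative b' j t) (at t)" for j t
    unfolding b_def b'_def
    by (rule DERIV_cmult, rule DERIV_chain2[OF has_derivative_max_0_square, THEN DERIV_cong])
       (auto intro!: derivative_eq_intros)
  show thesis
  proof
    show "weight W W'"
      unfolding weight_def
    proof (intro conjI allI)
      show "1 \<le> W t" for t
        by (simp add: W_def b_def sum_nonneg)
      fix t :: real
      obtain N where N: "t + 2 < real N"
        using reals_Archimedean2 by blast
      have "((\<lambda>t. 1 + (\<Sum>j<N. b j t)) has_real_derivative (\<Sum>j<N. b' j t)) (at t)"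
        by (auto intro!: derivative_eq_intros b)
      then have "(W has_real_derivative (\<Sum>j<N. b' j t)) (at t)"
      proof (rule has_field_derivative_transform_within_open[of _ _ _ "{..<t+1}"])
        fix r assume "r \<in> {..<t+1}"
        then show "1 + (\<Sum>j<N. b j r) = W r"
          using N by (simp add: W_eq[of r N])
      qed auto
      then show "(W has_real_derivative W' t) (at t)"
        using N by (simp add: W'_eq[of t N])
    next
      show "continuous_on UNIV W'"
      proof (rule continuous_at_imp_continuous_on, rule ballI)
        fix t :: real
        obtain N where N: "t + 2 < real N"
          using reals_Archimedean2 by blast
        have "continuous_on {..<t+1} (\<lambda>t. \<Sum>j<N. b' j t)"
          by (intro continuous_intros continuous_on_subset[OF cont]) auto
        then have "continuous_on {..<t+1} W'"
          by (rule continuous_on_eq) (use N in \<open>simp add: W'_eq[of _ N]\<close>)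
        then show "isCont W' t"
          by (simp add: continuous_on_eq_continuous_at)
      qed
    qed
    fix t q assume tq: "(t, q) \<in> D" "0 \<le> t"
    define j where "j = nat \<lfloor>t\<rfloor>"
    have j: "real j \<le> t" "t \<le> real j + 1" and "j < nat \<lceil>t + 1\<rceil>"
      using tq unfolding j_def by linarith+
    have "h t q \<le> \<bar>C (real j + 1)\<bar> * 1"
      using C[OF tq j(2)] by simp
    also have "\<dots> \<le> b j t"
      unfolding b_def using j by (intro mult_left_mono) auto
    also have "\<dots> \<le> (\<Sum>j<nat \<lceil>t + 1\<rceil>. b j t)"
      using \<open>j < _\<close> by (intro member_le_sum) (auto simp: b_def)
    finally show "h t q \<le> W t"
      by (simp add: W_def)
  qed
qed

lemma weight_majorant_continuous:
  assumes "continuous_on {0..} h"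
  obtains W W' where "weight W W'" "\<And>t. 0 \<le> t \<Longrightarrow> h t \<le> W t"
proof -
  have "\<exists>C. \<forall>(t, q)\<in>UNIV. 0 \<le> t \<and> t \<le> T \<longrightarrow> h t \<le> C" for T
  proof -
    have "compact (h ` {0..T})"
      by (intro compact_continuous_image continuous_on_subset[OF assms]) auto
    then obtain C where "\<forall>y\<in>h ` {0..T}. \<bar>y\<bar> \<le> C"
      using bounded_real compact_imp_bounded by blast
    then show ?thesis
      by (intro exI[of _ C]) (auto simp: abs_le_iff)
  qed
  from weight_majorant[where h = "\<lambda>t _. h t" and D = UNIV, OF this] that show thesis
    by (metis UNIV_I)
qed

section \<open>Limits that are uniform over a family of trajectories\<close>

text \<open>Convergence to 0 as time tends to infinity, uniformly over \<open>A\<close>. Expressed with a product filter, it inherits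
  the calculus of limits.\<close>

definition vanishes :: "'p set \<Rightarrow> ('p \<Rightarrow> real \<Rightarrow> real) \<Rightarrow> bool" where
  "vanishes A g \<longleftrightarrow> ((\<lambda>(p, t). g p t) \<longlongrightarrow> 0) (principal A \<times>\<^sub>F at_top)"

text \<open>Uniform convergence needs control of the transients that is uniform over the family as well.
  This is what boundedness on each compact time interval provides.\<close>

definition locally_bounded :: "'p set \<Rightarrow> real \<Rightarrow> ('p \<Rightarrow> real \<Rightarrow> 'b::real_normed_vector) \<Rightarrow> bool" where
  "locally_bounded A s g \<longleftrightarrow> (\<forall>T. \<exists>C. \<forall>p\<in>A. \<forall>t\<in>{s..T}. norm (g p t) \<le> C)"

lemma eventually_uniformly:
  "eventually (\<lambda>(p, t). Q p t) (principal A \<times>\<^sub>F at_top) \<longleftrightarrow> (\<exists>T::real. \<forall>p\<in>A. \<forall>t\<ge>T. Q p t)"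
proof
  assume "eventually (\<lambda>(p, t). Q p t) (principal A \<times>\<^sub>F at_top)"
  then obtain P R where "\<forall>p\<in>A. P p" "eventually R at_top" "\<And>p t. P p \<Longrightarrow> R t \<Longrightarrow> Q p t"
    by (auto simp: eventually_prod_filter eventually_principal)
  then show "\<exists>T::real. \<forall>p\<in>A. \<forall>t\<ge>T. Q p t"
    by (metis eventually_at_top_linorder)
next
  assume "\<exists>T::real. \<forall>p\<in>A. \<forall>t\<ge>T. Q p t"
  then obtain T :: real where T: "\<forall>p\<in>A. \<forall>t\<ge>T. Q p t"
    by blast
  show "eventually (\<lambda>(p, t). Q p t) (principal A \<times>\<^sub>F at_top)"
    unfolding eventually_prod_filter eventually_principal
    by (rule exI[of _ "\<lambda>p. p \<in> A"], rule exI[of _ "\<lambda>t. T \<le> t"])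
       (use T in \<open>simp add: eventually_ge_at_top\<close>)
qed

lemma vanishes_iff:
  "vanishes A g \<longleftrightarrow> (\<forall>\<epsilon>>0. \<exists>T. \<forall>p\<in>A. \<forall>t\<ge>T. \<bar>g p t\<bar> < \<epsilon>)"
  unfolding vanishes_def tendsto_iff
  by (simp add: case_prod_beta eventually_uniformly[of "\<lambda>p t. \<bar>g p t\<bar> < _", unfolded case_prod_beta])

lemma vanishes_le:
  assumes h: "vanishes A h" and le: "\<And>p t. p \<in> A \<Longrightarrow> T \<le> t \<Longrightarrow> \<bar>g p t\<bar> \<le> h p t"
  shows "vanishes A g"
  unfolding vanishes_def
proof (rule Lim_null_comparison)
  show "((\<lambda>(p, t). h p t) \<longlongrightarrow> 0) (principal A \<times>\<^sub>F at_top)"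
    using h by (simp add: vanishes_def)
  have "eventually (\<lambda>(p, t). \<bar>g p t\<bar> \<le> h p t) (principal A \<times>\<^sub>F at_top)"
    unfolding eventually_uniformly using le by blast
  then show "eventually (\<lambda>x. norm (case x of (p, t) \<Rightarrow> g p t) \<le> (case x of (p, t) \<Rightarrow> h p t))
      (principal A \<times>\<^sub>F at_top)"
    by (rule eventually_mono) auto
qed

lemma vanishes_abs: "vanishes A g \<Longrightarrow> vanishes A (\<lambda>p t. \<bar>g p t\<bar>)"
  by (simp add: vanishes_iff)

lemma vanishes_add: "vanishes A g \<Longrightarrow> vanishes A h \<Longrightarrow> vanishes A (\<lambda>p t. g p t + h p t)"
  unfolding vanishes_def case_prod_beta by (rule tendsto_add_zero)

lemma vanishes_sum:
  "(\<And>i. i \<in> I \<Longrightarrow> vanishes A (g i)) \<Longrightarrow> vanishes A (\<lambda>p t. \<Sum>i\<in>I. g i p t)"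
  unfolding vanishes_def case_prod_beta by (rule tendsto_null_sum)

lemma vanishes_cmult: "vanishes A g \<Longrightarrow> vanishes A (\<lambda>p t. c * g p t)"
  unfolding vanishes_def case_prod_beta by (rule tendsto_mult_right_zero)

lemma vanishes_root:
  assumes "vanishes A g" "0 < m"
  shows "vanishes A (\<lambda>p t. root m (g p t))"
  using tendsto_real_root[of "\<lambda>(p, t). g p t" 0 _ m] assms
  unfolding vanishes_def case_prod_beta by simp

lemma vanishes_of_real_function:
  assumes "(h \<longlongrightarrow> 0) at_top"
  shows "vanishes A (\<lambda>p t. h t)"
  using assms unfolding vanishes_iff tendsto_iff eventually_at_top_linorder by auto

lemma locally_boundedE:
  assumes "locally_bounded A s g"
  obtains C where "0 \<le> C" "\<And>p t. p \<in> A \<Longrightarrow> s \<le> t \<Longrightarrow> t \<le> T \<Longrightarrow> norm (g p t) \<le> C"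
proof -
  obtain C where "\<forall>p\<in>A. \<forall>t\<in>{s..T}. norm (g p t) \<le> C"
    using assms unfolding locally_bounded_def by blast
  then show thesis
    by (intro that[of "\<bar>C\<bar>"]) (force intro: order_trans[OF _ abs_ge_self])+
qed

lemma locally_bounded_le:
  assumes "locally_bounded A s h"
    and "\<And>p t. p \<in> A \<Longrightarrow> s \<le> t \<Longrightarrow> norm (g p t) \<le> norm (h p t)"
  shows "locally_bounded A s g"
  using assms unfolding locally_bounded_def by (meson atLeastAtMost_iff order_trans)

lemma locally_bounded_real_function:
  assumes "continuous_on {s..} h"
  shows "locally_bounded A s (\<lambda>p t. h t)"
  unfolding locally_bounded_def
proof
  fix T
  have "compact (h ` {s..T})"
    by (intro compact_continuous_image continuous_on_subset[OF assms]) auto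
  then obtain C where "\<forall>y\<in>h ` {s..T}. norm y \<le> C"
    using bounded_iff compact_imp_bounded by metis
  then show "\<exists>C. \<forall>p\<in>A. \<forall>t\<in>{s..T}. norm (h t) \<le> C"
    by auto
qed

lemma locally_bounded_add:
  assumes "locally_bounded A s g" "locally_bounded A s h"
  shows "locally_bounded A s (\<lambda>p t. g p t + h p t)"
  unfolding locally_bounded_def
proof
  fix T
  obtain C where C: "\<And>p t. p \<in> A \<Longrightarrow> s \<le> t \<Longrightarrow> t \<le> T \<Longrightarrow> norm (g p t) \<le> C"
    using locally_boundedE[OF assms(1)] by metis
  obtain D where D: "\<And>p t. p \<in> A \<Longrightarrow> s \<le> t \<Longrightarrow> t \<le> T \<Longrightarrow> norm (h p t) \<le> D"
    using locally_boundedE[OF assms(2)] by metis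
  show "\<exists>C. \<forall>p\<in>A. \<forall>t\<in>{s..T}. norm (g p t + h p t) \<le> C"
    by (intro exI[of _ "C + D"] ballI order_trans[OF norm_triangle_ineq] add_mono C D) auto
qed

lemma locally_bounded_minus:
  "locally_bounded A s g \<Longrightarrow> locally_bounded A s (\<lambda>p t. - g p t)"
  by (simp add: locally_bounded_def)

lemma locally_bounded_diff:
  "locally_bounded A s g \<Longrightarrow> locally_bounded A s h \<Longrightarrow> locally_bounded A s (\<lambda>p t. g p t - h p t)"
  using locally_bounded_add[of A s g "\<lambda>p t. - h p t"] locally_bounded_minus[of A s h] by simp

lemma locally_bounded_mult:
  fixes g h :: "'p \<Rightarrow> real \<Rightarrow> real"
  assumes "locally_bounded A s g" "locally_bounded A s h"
  shows "locally_bounded A s (\<lambda>p t. g p t * h p t)"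
  unfolding locally_bounded_def
proof
  fix T
  obtain C where C: "0 \<le> C" "\<And>p t. p \<in> A \<Longrightarrow> s \<le> t \<Longrightarrow> t \<le> T \<Longrightarrow> norm (g p t) \<le> C"
    using locally_boundedE[OF assms(1)] by metis
  obtain D where D: "\<And>p t. p \<in> A \<Longrightarrow> s \<le> t \<Longrightarrow> t \<le> T \<Longrightarrow> norm (h p t) \<le> D"
    using locally_boundedE[OF assms(2)] by metis
  show "\<exists>C. \<forall>p\<in>A. \<forall>t\<in>{s..T}. norm (g p t * h p t) \<le> C"
    unfolding norm_mult by (intro exI[of _ "C * D"] ballI mult_mono C D) auto
qed

lemma locally_bounded_continuous_image:
  fixes g :: "'p \<Rightarrow> real \<Rightarrow> 'b::euclidean_space" and H :: "real \<Rightarrow> 'b \<Rightarrow> real"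
  assumes g: "locally_bounded A s g" and s: "0 \<le> s"
    and H: "continuous_on ({0..} \<times> UNIV) (\<lambda>(t, x). H t x)"
  shows "locally_bounded A s (\<lambda>p t. H t (g p t))"
  unfolding locally_bounded_def
proof
  fix T
  obtain C where C: "\<And>p t. p \<in> A \<Longrightarrow> s \<le> t \<Longrightarrow> t \<le> T \<Longrightarrow> norm (g p t) \<le> C"
    using locally_boundedE[OF g] by metis
  have "compact ((\<lambda>(t, x). H t x) ` ({s..T} \<times> cball 0 C))"
    using s by (intro compact_continuous_image continuous_on_subset[OF H] compact_Times) auto
  then obtain D where "\<forall>y\<in>(\<lambda>(t, x). H t x) ` ({s..T} \<times> cball 0 C). norm y \<le> D"
    using bounded_iff compact_imp_bounded by metis
  then show "\<exists>D. \<forall>p\<in>A. \<forall>t\<in>{s..T}. norm (H t (g p t)) \<le> D"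
    using C by (intro exI[of _ D]) fastforce
qed

text \<open>The equation forgets its value at any time \<open>T\<close> exponentially fast, and that value is bounded
  uniformly over the family; after time \<open>T\<close> the forcing term contributes at most the supremum of
  \<open>\<bar>g / c\<bar>\<close>.\<close>

lemma damped_family:
  fixes q g :: "'p \<Rightarrow> real \<Rightarrow> real"
  assumes c: "continuous_on {s..} c" and c_ge: "\<And>t. s \<le> t \<Longrightarrow> 1/2 \<le> c t"
    and q: "\<And>p t. p \<in> A \<Longrightarrow> s \<le> t \<Longrightarrow>
              (q p has_real_derivative g p t - c t * q p t) (at t within {s..})"
    and init: "\<And>p. p \<in> A \<Longrightarrow> \<bar>q p s\<bar> \<le> Q"
    and lb: "locally_bounded A s g"
    and van: "vanishes A (\<lambda>p t. g p t / c t)"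
  shows "locally_bounded A s q" "vanishes A q"
proof -
  have bound: "\<bar>q p b\<bar> \<le> M + exp (- (b - r) / 2) * \<bar>q p r\<bar>"
    if "p \<in> A" "s \<le> r" "r \<le> b" and "\<And>t. t \<in> {r..b} \<Longrightarrow> \<bar>g p t\<bar> \<le> c t * M" for p r b M
    using that by (intro damped_bound[where c = c and g = "g p"] DERIV_subset[OF q] c_ge
        continuous_on_subset[OF c]) auto
  show lbq: "locally_bounded A s q"
    unfolding locally_bounded_def
  proof
    fix T
    obtain C where C: "0 \<le> C" "\<And>p t. p \<in> A \<Longrightarrow> s \<le> t \<Longrightarrow> t \<le> T \<Longrightarrow> norm (g p t) \<le> C"
      using locally_boundedE[OF lb] by metis
    have "\<bar>q p t\<bar> \<le> 2 * C + Q" if "p \<in> A" "s \<le> t" "t \<le> T" for p t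
    proof -
      have "\<bar>g p r\<bar> \<le> c r * (2 * C)" if "r \<in> {s..t}" for r
      proof -
        have "\<bar>g p r\<bar> \<le> 1/2 * (2 * C)"
          using C(2)[of p r] that \<open>p \<in> A\<close> \<open>t \<le> T\<close> by simp
        also have "\<dots> \<le> c r * (2 * C)"
          using c_ge[of r] that C(1) by (intro mult_right_mono) auto
        finally show ?thesis .
      qed
      then have "\<bar>q p t\<bar> \<le> 2 * C + exp (- (t - s) / 2) * \<bar>q p s\<bar>"
        using that by (intro bound) auto
      also have "\<dots> \<le> 2 * C + 1 * Q"
        using init[OF \<open>p \<in> A\<close>] that by (intro add_left_mono mult_mono) auto
      finally show ?thesis by simp
    qed
    then show "\<exists>C. \<forall>p\<in>A. \<forall>t\<in>{s..T}. norm (q p t) \<le> C"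
      by (intro exI[of _ "2 * C + Q"]) simp
  qed
  show "vanishes A q"
    unfolding vanishes_iff
  proof (intro allI impI)
    fix \<epsilon> :: real assume "0 < \<epsilon>"
    then obtain T0 where T0: "\<And>p t. p \<in> A \<Longrightarrow> T0 \<le> t \<Longrightarrow> \<bar>g p t / c t\<bar> < \<epsilon>/2"
      using van unfolding vanishes_iff by (metis half_gt_zero)
    define T where "T = max s T0"
    obtain C where C: "0 \<le> C" "\<And>p. p \<in> A \<Longrightarrow> \<bar>q p T\<bar> \<le> C"
      using locally_boundedE[OF lbq, of T] unfolding T_def by (metis max.cobounded1 order_refl real_norm_def)
    have "((\<lambda>b. exp (- (b - T) / 2) * C) \<longlongrightarrow> 0) at_top"
      by real_asymp
    then obtain T1 where T1: "\<And>b. T1 \<le> b \<Longrightarrow> exp (- (b - T) / 2) * C < \<epsilon>/2"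
      using \<open>0 < \<epsilon>\<close> C(1) unfolding tendsto_iff eventually_at_top_linorder
      by (fastforce dest: spec[of _ "\<epsilon>/2"])
    have "\<bar>q p b\<bar> < \<epsilon>" if "p \<in> A" "max T T1 \<le> b" for p b
    proof -
      have "\<bar>g p t\<bar> \<le> c t * (\<epsilon>/2)" if "t \<in> {T..b}" for t
      proof -
        have "0 < c t"
          using c_ge[of t] that by (simp add: T_def)
        then show ?thesis
          using T0[OF \<open>p \<in> A\<close>, of t] that by (simp add: T_def field_simps)
      qed
      then have "\<bar>q p b\<bar> \<le> \<epsilon>/2 + exp (- (b - T) / 2) * \<bar>q p T\<bar>"
        using that by (intro bound) (auto simp: T_def)
      also have "\<dots> \<le> \<epsilon>/2 + exp (- (b - T) / 2) * C"
        using C(2)[OF \<open>p \<in> A\<close>] by (intro add_left_mono mult_left_mono) auto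
      also have "\<dots> < \<epsilon>"
        using T1[of b] that by simp
      finally show ?thesis .
    qed
    then show "\<exists>T. \<forall>p\<in>A. \<forall>t\<ge>T. \<bar>q p t\<bar> < \<epsilon>"
      by blast
  qed
qed

text \<open>Here \<open>U\<close> is an approximation of \<open>X\<close>, and \<open>K (U - Z)\<close> serves as an approximation of the derivative
  \<open>\<xi>\<close> of \<open>X\<close>. The summand \<open>K'/K\<close> in the rate of the filter is chosen such that \<open>v = K (Z - X) + \<xi>\<close> is
  damped at the rate \<open>K\<close> exactly: \<open>v' = - K v + (K\<^sup>2 + K') (U - X) + \<eta>\<close>. The weight \<open>\<Omega>\<close> measures how
  fast \<open>v\<close> tends to 0; it changes the damping of \<open>\<Omega> v\<close> to \<open>K - \<Omega>'/\<Omega>\<close>, which is at least \<open>K/2\<close>.\<close>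

lemma high_gain_tracking:
  fixes X \<xi> \<eta> U Z :: "'p \<Rightarrow> real \<Rightarrow> real"
  assumes s: "0 \<le> s" and K: "weight K K'" and \<Omega>: "weight \<Omega> \<Omega>'"
    and dom: "\<And>t. 0 \<le> t \<Longrightarrow> 2 * \<bar>\<Omega>' t\<bar> \<le> K t"
    and X: "\<And>p t. p \<in> A \<Longrightarrow> s \<le> t \<Longrightarrow> (X p has_real_derivative \<xi> p t) (at t within {s..})"
    and \<xi>: "\<And>p t. p \<in> A \<Longrightarrow> s \<le> t \<Longrightarrow> (\<xi> p has_real_derivative \<eta> p t) (at t within {s..})"
    and Z: "\<And>p t. p \<in> A \<Longrightarrow> s \<le> t \<Longrightarrow>
              (Z p has_real_derivative (K t + K' t / K t) * (U p t - Z p t)) (at t within {s..})"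
    and Z_init: "\<And>p. p \<in> A \<Longrightarrow> \<bar>Z p s\<bar> \<le> C"
    and lb: "locally_bounded A s X" "locally_bounded A s \<xi>" "locally_bounded A s \<eta>"
      "locally_bounded A s U"
    and van_\<eta>: "vanishes A (\<lambda>p t. \<Omega> t * \<bar>\<eta> p t\<bar> / K t)"
    and van_e: "vanishes A (\<lambda>p t. \<Omega> t * ((K t)\<^sup>2 + \<bar>K' t\<bar>) * \<bar>U p t - X p t\<bar>)"
  shows "locally_bounded A s Z" "vanishes A (\<lambda>p t. \<Omega> t * (K t * (U p t - Z p t) - \<xi> p t))"
proof -
  note Kp = weightD(5)[OF K] and Kge = weightD(4)[OF K]
    and \<Omega>p = weightD(5)[OF \<Omega>] and \<Omega>ge = weightD(4)[OF \<Omega>]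
  define q where "q p t = \<Omega> t * (K t * (Z p t - X p t) + \<xi> p t)" for p t
  define g where "g p t = \<Omega> t * (((K t)\<^sup>2 + K' t) * (U p t - X p t) + \<eta> p t)" for p t
  define c where "c t = K t - \<Omega>' t / \<Omega> t" for t
  have c_ge: "K t / 2 \<le> c t" if "0 \<le> t" for t
  proof -
    have "\<Omega>' t / \<Omega> t \<le> \<bar>\<Omega>' t\<bar> / 1"
      using \<Omega>ge[of t] \<Omega>p[of t] by (intro frac_le) auto
    then show ?thesis
      using dom[OF that] unfolding c_def by linarith
  qed
  have cont_c: "continuous_on {s..} c"
    unfolding c_def using \<Omega>p
    by (intro continuous_intros weightD[OF K] weightD[OF \<Omega>]) (auto simp: less_le)
  have dq: "(q p has_real_derivative g p t - c t * q p t) (at t within {s..})"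
    if "p \<in> A" "s \<le> t" for p t
  proof -
    have eq: "K t * ((K t + K' t / K t) * (U p t - Z p t) - \<xi> p t) =
        ((K t)\<^sup>2 + K' t) * (U p t - Z p t) - K t * \<xi> p t"
      using Kp[of t] by (simp add: field_simps power2_eq_square)
    have "(q p has_real_derivative
        \<Omega>' t * (K t * (Z p t - X p t) + \<xi> p t) + \<Omega> t * (K' t * (Z p t - X p t) +
        K t * ((K t + K' t / K t) * (U p t - Z p t) - \<xi> p t) + \<eta> p t)) (at t within {s..})"
      unfolding q_def
      by (rule derivative_eq_intros weightD(1)[OF \<Omega>] weightD(1)[OF K] X[OF that] Z[OF that] \<xi>[OF that] refl)+
         (simp add: algebra_simps)
    then show ?thesis
      unfolding eq by (rule DERIV_cong)
        (use \<Omega>p[of t] in \<open>simp add: g_def c_def q_def field_simps power2_eq_square\<close>)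
  qed
  have lbK: "locally_bounded A s (\<lambda>p t. K t)" "locally_bounded A s (\<lambda>p t. K' t)"
    "locally_bounded A s (\<lambda>p t. \<Omega> t)"
    by (intro locally_bounded_real_function weightD[OF K] weightD[OF \<Omega>])+
  have lbg: "locally_bounded A s g"
    unfolding g_def power2_eq_square
    by (intro locally_bounded_mult locally_bounded_add locally_bounded_diff lb lbK)
  have init: "\<bar>q p s\<bar> \<le> \<Omega> s * (K s * (C + Cx) + C\<xi>)"
    if "p \<in> A" "\<bar>X p s\<bar> \<le> Cx" "\<bar>\<xi> p s\<bar> \<le> C\<xi>" for p Cx C\<xi>
  proof -
    have "\<bar>q p s\<bar> = \<Omega> s * \<bar>K s * (Z p s - X p s) + \<xi> p s\<bar>"
      using \<Omega>p[of s] by (simp add: q_def abs_mult)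
    also have "\<bar>K s * (Z p s - X p s) + \<xi> p s\<bar> \<le> K s * \<bar>Z p s - X p s\<bar> + \<bar>\<xi> p s\<bar>"
      using Kp[of s] by (intro order_trans[OF abs_triangle_ineq]) (simp add: abs_mult)
    also have "\<dots> \<le> K s * (C + Cx) + C\<xi>"
      using Kp[of s] Z_init[OF that(1)] that(2,3) by (intro add_mono mult_left_mono) auto
    finally show ?thesis
      using \<Omega>p[of s] by simp
  qed
  obtain Cx where Cx: "\<And>p. p \<in> A \<Longrightarrow> \<bar>X p s\<bar> \<le> Cx"
    using locally_boundedE[OF lb(1), of s] by (metis order_refl real_norm_def)
  obtain C\<xi> where C\<xi>: "\<And>p. p \<in> A \<Longrightarrow> \<bar>\<xi> p s\<bar> \<le> C\<xi>"
    using locally_boundedE[OF lb(2), of s] by (metis order_refl real_norm_def)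
  have van_g: "vanishes A (\<lambda>p t. g p t / c t)"
  proof (rule vanishes_le[where T = s])
    show "vanishes A (\<lambda>p t. 2 * (\<Omega> t * ((K t)\<^sup>2 + \<bar>K' t\<bar>) * \<bar>U p t - X p t\<bar> + \<Omega> t * \<bar>\<eta> p t\<bar> / K t))"
      by (intro vanishes_cmult vanishes_add van_\<eta> van_e)
    fix p t assume "p \<in> A" "s \<le> t"
    then have c: "K t / 2 \<le> c t" "0 < c t"
      using c_ge[of t] Kp[of t] s by linarith+
    have "\<bar>g p t / c t\<bar> \<le> \<bar>g p t\<bar> / (K t / 2)"
      unfolding abs_divide using c Kp[of t] by (intro divide_left_mono) auto
    also have "\<bar>g p t\<bar> \<le> \<Omega> t * (((K t)\<^sup>2 + \<bar>K' t\<bar>) * \<bar>U p t - X p t\<bar> + \<bar>\<eta> p t\<bar>)"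
    proof -
      have "\<bar>((K t)\<^sup>2 + K' t) * (U p t - X p t) + \<eta> p t\<bar>
          \<le> \<bar>(K t)\<^sup>2 + K' t\<bar> * \<bar>U p t - X p t\<bar> + \<bar>\<eta> p t\<bar>"
        by (simp flip: abs_mult)
      also have "\<dots> \<le> ((K t)\<^sup>2 + \<bar>K' t\<bar>) * \<bar>U p t - X p t\<bar> + \<bar>\<eta> p t\<bar>"
        by (intro add_mono mult_right_mono order_trans[OF abs_triangle_ineq]) auto
      finally show ?thesis
        using \<Omega>p[of t] by (simp add: g_def abs_mult)
    qed
    also have "\<Omega> t * (((K t)\<^sup>2 + \<bar>K' t\<bar>) * \<bar>U p t - X p t\<bar> + \<bar>\<eta> p t\<bar>) / (K t / 2)
       = 2 * (\<Omega> t * ((K t)\<^sup>2 + \<bar>K' t\<bar>) * \<bar>U p t - X p t\<bar> / K t + \<Omega> t * \<bar>\<eta> p t\<bar> / K t)"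
      by (simp add: add_divide_distrib algebra_simps)
    also have "\<dots> \<le> 2 * (\<Omega> t * ((K t)\<^sup>2 + \<bar>K' t\<bar>) * \<bar>U p t - X p t\<bar> / 1 + \<Omega> t * \<bar>\<eta> p t\<bar> / K t)"
      using Kge[of t] Kp[of t] \<Omega>p[of t]
      by (intro mult_left_mono add_right_mono divide_left_mono mult_nonneg_nonneg) auto
    finally show "\<bar>g p t / c t\<bar> \<le> 2 * (\<Omega> t * ((K t)\<^sup>2 + \<bar>K' t\<bar>) * \<bar>U p t - X p t\<bar> + \<Omega> t * \<bar>\<eta> p t\<bar> / K t)"
      using Kp[of t] by (simp add: divide_right_mono)
  qed
  have half: "1/2 \<le> c t" if "s \<le> t" for t
    using c_ge[of t] Kge[of t] that s by linarith
  note family = damped_family[OF cont_c half dq init[OF _ Cx C\<xi>] lbg van_g]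
  have lbq: "locally_bounded A s q" and vq: "vanishes A q"
    by (rule family; assumption)+
  have "\<bar>Z p t\<bar> \<le> \<bar>q p t\<bar> + (\<bar>\<xi> p t\<bar> + \<bar>X p t\<bar>)" for p t
  proof -
    have "Z p t - X p t = (q p t / \<Omega> t - \<xi> p t) / K t"
      using Kp[of t] \<Omega>p[of t] by (simp add: q_def)
    then have "\<bar>Z p t - X p t\<bar> = \<bar>q p t / \<Omega> t - \<xi> p t\<bar> / K t"
      using Kp[of t] by (simp add: abs_divide)
    also have "\<dots> \<le> \<bar>q p t / \<Omega> t - \<xi> p t\<bar> / 1"
      using Kge[of t] by (intro divide_left_mono) auto
    also have "\<dots> \<le> \<bar>q p t\<bar> / \<Omega> t + \<bar>\<xi> p t\<bar>"
      using \<Omega>p[of t] abs_triangle_ineq4[of "q p t / \<Omega> t" "\<xi> p t"] by (simp add: abs_divide)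
    also have "\<bar>q p t\<bar> / \<Omega> t \<le> \<bar>q p t\<bar> / 1"
      using \<Omega>ge[of t] by (intro divide_left_mono) auto
    finally show ?thesis
      by linarith
  qed
  moreover have "locally_bounded A s (\<lambda>p t. \<bar>q p t\<bar> + (\<bar>\<xi> p t\<bar> + \<bar>X p t\<bar>))"
    using lbq lb by (intro locally_bounded_add) (simp_all add: locally_bounded_def)
  ultimately show "locally_bounded A s Z"
    by (elim locally_bounded_le) (simp add: abs_of_nonneg add_nonneg_nonneg)
  show "vanishes A (\<lambda>p t. \<Omega> t * (K t * (U p t - Z p t) - \<xi> p t))"
  proof (rule vanishes_le[where T = s])
    show "vanishes A (\<lambda>p t. \<Omega> t * ((K t)\<^sup>2 + \<bar>K' t\<bar>) * \<bar>U p t - X p t\<bar> + \<bar>q p t\<bar>)"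
      by (intro vanishes_add van_e vanishes_abs vq)
    fix p t
    have "\<Omega> t * (K t * (U p t - Z p t) - \<xi> p t) = \<Omega> t * K t * (U p t - X p t) - q p t"
      by (simp add: q_def algebra_simps)
    then have "\<bar>\<Omega> t * (K t * (U p t - Z p t) - \<xi> p t)\<bar> \<le> \<Omega> t * K t * \<bar>U p t - X p t\<bar> + \<bar>q p t\<bar>"
      using \<Omega>p[of t] Kp[of t] abs_triangle_ineq4[of "\<Omega> t * K t * (U p t - X p t)" "q p t"]
      by (simp add: abs_mult)
    also have "K t \<le> (K t)\<^sup>2 + \<bar>K' t\<bar>"
      using Kge[of t] by (simp add: power2_eq_square add_increasing2)
    finally show "\<bar>\<Omega> t * (K t * (U p t - Z p t) - \<xi> p t)\<bar>
        \<le> \<Omega> t * ((K t)\<^sup>2 + \<bar>K' t\<bar>) * \<bar>U p t - X p t\<bar> + \<bar>q p t\<bar>"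
      using \<Omega>p[of t] by (simp add: mult_right_mono mult_left_mono)
  qed
qed

section \<open>Vectors, roots and continuously differentiable functions\<close>

lemma has_vector_derivative_cart:
  fixes z :: "real \<Rightarrow> real^'n"
  shows "(z has_vector_derivative v) (at t within S) \<longleftrightarrow>
    (\<forall>k. ((\<lambda>t. z t $ k) has_real_derivative v $ k) (at t within S))"
proof -
  have "(z has_vector_derivative v) (at t within S) \<longleftrightarrow>
      (\<forall>k. ((\<lambda>t. z t $ k) has_derivative (\<lambda>h. h * v $ k)) (at t within S))"
    unfolding has_vector_derivative_def
    by (subst has_derivative_componentwise_within) (simp add: Basis_vec_def inner_axis)
  moreover have "(\<lambda>h. h * v $ k) = (*) (v $ k)" for k
    by (simp add: fun_eq_iff mult.commute)
  ultimately show ?thesis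
    by (simp add: has_field_derivative_def)
qed

lemma is_solution_subset: "is_solution F J x \<Longrightarrow> I \<subseteq> J \<Longrightarrow> is_solution F I x"
  unfolding is_solution_def by (meson has_vector_derivative_within_subset subset_iff)

lemma axis_eq_scaleR: "axis k (c::real) = c *\<^sub>R axis k 1"
  by (simp add: vec_eq_iff axis_def)

lemma continuous_on_axis:
  fixes g :: "'a::topological_space \<Rightarrow> real"
  shows "continuous_on S g \<Longrightarrow> continuous_on S (\<lambda>x. axis k (g x))"
  by (subst axis_eq_scaleR) (intro continuous_intros)

lemma norm_axis_real: "norm (axis k (c::real)) = \<bar>c\<bar>"
  by (subst axis_eq_scaleR) simp

lemma superadditive_power:
  fixes c d :: real
  assumes "0 \<le> c" "0 \<le> d" "0 < m"
  shows "c ^ m + d ^ m \<le> (c + d) ^ m"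
  using assms(3)
proof (induction m rule: nat_induct_non_zero)
  case (Suc m)
  have "c ^ Suc m + d ^ Suc m \<le> (c + d) * (c ^ m + d ^ m)"
    using assms by (simp add: algebra_simps)
  also have "\<dots> \<le> (c + d) ^ Suc m"
    using Suc.IH assms by (simp add: mult_left_mono)
  finally show ?case .
qed simp

text \<open>For the midpoint \<open>c\<close> and the half distance \<open>d\<close> of \<open>p\<close> and \<open>q\<close>, the right-hand side is
  \<open>(d + c)\<^sup>m + (d - c)\<^sup>m\<close>. One summand is at least \<open>\<bar>c\<bar>\<^sup>m + d\<^sup>m\<close>, the other at least \<open>- \<bar>c\<bar>\<^sup>m\<close>.\<close>

lemma odd_power_difference:
  fixes p q :: real
  assumes "odd m" "q \<le> p"
  shows "((p - q) / 2) ^ m \<le> p ^ m - q ^ m"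
proof -
  define c d where "c = (p + q) / 2" and "d = (p - q) / 2"
  have pq: "p = d + c" "q = - (d - c)" and d: "0 \<le> d" and m: "0 < m"
    using assms by (auto simp: c_def d_def field_simps odd_pos)
  have key: "d ^ m \<le> (d + r) ^ m + (d - r) ^ m" if r: "0 \<le> r" for r
  proof -
    have "r ^ m + d ^ m \<le> (d + r) ^ m"
      using superadditive_power[OF r d m] by (simp add: add.commute)
    moreover have "(- r) ^ m \<le> (d - r) ^ m"
      using d assms(1) by (intro power_mono_odd) auto
    ultimately show ?thesis
      using assms(1) by simp
  qed
  have "d ^ m \<le> (d + c) ^ m + (d - c) ^ m"
    using key[of c] key[of "- c"] by (cases "0 \<le> c") auto
  also have "\<dots> = p ^ m - q ^ m"
    unfolding pq using assms(1) by (subst power_minus_odd) simp_all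
  finally show ?thesis
    by (simp add: d_def)
qed

text \<open>Global Hoelder continuity with exponent \<open>1/m\<close>, by the preceding inequality for the roots of \<open>u\<close>
  and \<open>v\<close>. It quantifies how errors propagate from one estimate to the next.\<close>

lemma odd_root_hoelder:
  assumes "odd m"
  shows "\<bar>root m u - root m v\<bar> \<le> 2 * root m \<bar>u - v\<bar>"
proof -
  have m: "0 < m"
    using assms by (rule odd_pos)
  have *: "root m u - root m v \<le> 2 * root m \<bar>u - v\<bar>" if "v \<le> u" for u v
  proof -
    have "((root m u - root m v) / 2) ^ m \<le> root m u ^ m - root m v ^ m"
      using that m by (intro odd_power_difference assms) simp
    also have "\<dots> = \<bar>u - v\<bar>"
      using that assms by (simp add: odd_real_root_pow)
    finally have "root m (((root m u - root m v) / 2) ^ m) \<le> root m \<bar>u - v\<bar>"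
      using m by simp
    then show ?thesis
      using assms by (simp add: odd_real_root_power_cancel)
  qed
  show ?thesis
    using *[of v u] *[of u v] m by (cases "v \<le> u") (auto simp: abs_minus_commute abs_if)
qed

lemma continuous_on_compose_triple:
  fixes H :: "real \<Rightarrow> 'b::topological_space \<Rightarrow> 'c::topological_space \<Rightarrow> 'd::topological_space"
  assumes H: "continuous_on ({0..} \<times> UNIV \<times> UNIV) (\<lambda>(t, x, v). H t x v)"
    and g: "continuous_on S g\<^sub>1" "continuous_on S g\<^sub>2" "continuous_on S g\<^sub>3"
    and nonneg: "\<And>p. p \<in> S \<Longrightarrow> 0 \<le> g\<^sub>1 p"
  shows "continuous_on S (\<lambda>p. H (g\<^sub>1 p) (g\<^sub>2 p) (g\<^sub>3 p))"
proof -
  have "continuous_on S (\<lambda>p. (\<lambda>(t, x, v). H t x v) (g\<^sub>1 p, g\<^sub>2 p, g\<^sub>3 p))"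
    by (rule continuous_on_compose2[OF H]) (use nonneg in \<open>auto intro!: continuous_on_Pair g\<close>)
  then show ?thesis
    by simp
qed

lemma C1_on_imp_continuous_on: "C1_on S g \<Longrightarrow> continuous_on S g"
  unfolding C1_on_def by (meson has_derivative_continuous_on)

text \<open>\<open>D t x v\<close> is the derivative of \<open>g\<close> at \<open>(t, x)\<close> in the direction \<open>(1, v)\<close>. Its joint continuity makes
  derivatives along trajectories bounded on compact sets.\<close>

lemma C1_on_chain_rule:
  fixes g :: "real \<Rightarrow> 'b::euclidean_space \<Rightarrow> real"
  assumes "C1_on ({0..} \<times> UNIV) (\<lambda>(t, x). g t x)"
  obtains D where "continuous_on ({0..} \<times> UNIV \<times> UNIV) (\<lambda>(t, x, v). D t x v)"
    "\<And>s t x v. 0 \<le> s \<Longrightarrow> s \<le> t \<Longrightarrow> (x has_vector_derivative v) (at t within {s..}) \<Longrightarrow>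
       ((\<lambda>t. g t (x t)) has_real_derivative D t (x t) v) (at t within {s..})"
proof -
  obtain g' where
    g': "\<And>p. p \<in> {0..} \<times> UNIV \<Longrightarrow>
      ((\<lambda>(t, x). g t x) has_derivative blinfun_apply (g' p)) (at p within {0..} \<times> UNIV)"
    and cont: "continuous_on ({0..} \<times> UNIV) g'"
    using assms unfolding C1_on_def by blast
  show thesis
  proof
    show "continuous_on ({0..} \<times> UNIV \<times> UNIV) (\<lambda>(t, x, v). blinfun_apply (g' (t, x)) (1, v))"
      unfolding case_prod_beta
      by (intro continuous_intros continuous_on_compose2[OF cont]) auto
    fix s t :: real and x :: "real \<Rightarrow> 'b" and v
    assume st: "0 \<le> s" "s \<le> t" and x: "(x has_vector_derivative v) (at t within {s..})"
    have "((\<lambda>t. (t, x t)) has_derivative (\<lambda>h. (h, h *\<^sub>R v))) (at t within {s..})"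
      using x unfolding has_vector_derivative_def by (intro derivative_intros)
    moreover have "((\<lambda>(t, x). g t x) has_derivative blinfun_apply (g' (t, x t)))
        (at (t, x t) within (\<lambda>t. (t, x t)) ` {s..})"
      using st by (intro has_derivative_subset[OF g']) auto
    ultimately have "((\<lambda>t. (\<lambda>(t, x). g t x) (t, x t)) has_derivative
        (\<lambda>h. blinfun_apply (g' (t, x t)) (h, h *\<^sub>R v))) (at t within {s..})"
      by (rule has_derivative_in_compose)
    moreover have "blinfun_apply (g' (t, x t)) (h, h *\<^sub>R v) = blinfun_apply (g' (t, x t)) (1, v) * h" for h
      using blinfun.scaleR_right[of "g' (t, x t)" h "(1, v)"] by simp
    ultimately show "((\<lambda>t. g t (x t)) has_real_derivative blinfun_apply (g' (t, x t)) (1, v)) (at t within {s..})"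
      by (simp add: has_field_derivative_def)
  qed
qed

lemma C1_on_lipschitz_on_cball:
  fixes g :: "real \<Rightarrow> 'b::euclidean_space \<Rightarrow> real"
  assumes "C1_on ({0..} \<times> UNIV) (\<lambda>(t, x). g t x)"
  obtains L where "\<And>t x x'. 0 \<le> t \<Longrightarrow> t \<le> T \<Longrightarrow> norm x \<le> r \<Longrightarrow> norm x' \<le> r \<Longrightarrow>
    \<bar>g t x - g t x'\<bar> \<le> L * norm (x - x')"
proof -
  obtain g' where
    g': "\<And>p. p \<in> {0..} \<times> UNIV \<Longrightarrow>
      ((\<lambda>(t, x). g t x) has_derivative blinfun_apply (g' p)) (at p within {0..} \<times> UNIV)"
    and cont: "continuous_on ({0..} \<times> UNIV) g'"
    using assms unfolding C1_on_def by blast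
  define S where "S = {0..T} \<times> cball (0::'b) r"
  have "compact (g' ` S)"
    unfolding S_def
    by (intro compact_continuous_image continuous_on_subset[OF cont] compact_Times) auto
  then obtain L where L: "\<forall>y\<in>g' ` S. norm y \<le> L"
    using bounded_iff compact_imp_bounded by metis
  have S: "convex S"
    unfolding S_def by (intro convex_Times) auto
  show thesis
  proof
    fix t and x x' :: 'b assume *: "0 \<le> t" "t \<le> T" "norm x \<le> r" "norm x' \<le> r"
    have "norm ((\<lambda>(t, x). g t x) (t, x) - (\<lambda>(t, x). g t x) (t, x')) \<le> L * norm ((t, x) - (t, x'))"
    proof (rule differentiable_bound[OF S])
      show "((\<lambda>(t, x). g t x) has_derivative blinfun_apply (g' p)) (at p within S)" if "p \<in> S" for p
        using that by (intro has_derivative_subset[OF g']) (auto simp: S_def)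
      show "onorm (blinfun_apply (g' p)) \<le> L" if "p \<in> S" for p
        using L that by (simp flip: norm_blinfun.rep_eq)
    qed (use * in \<open>auto simp: S_def\<close>)
    then show "\<bar>g t x - g t x'\<bar> \<le> L * norm (x - x')"
      by (simp add: norm_Pair)
  qed
qed

lemma continuous_bounded_on_cball:
  fixes g :: "real \<Rightarrow> 'b::euclidean_space \<Rightarrow> real"
  assumes "continuous_on ({0..} \<times> UNIV) (\<lambda>(t, x). g t x)"
  obtains C where "\<And>t x. 0 \<le> t \<Longrightarrow> t \<le> T \<Longrightarrow> norm x \<le> r \<Longrightarrow> \<bar>g t x\<bar> \<le> C"
proof -
  have "compact ((\<lambda>(t, x). g t x) ` ({0..T} \<times> cball 0 r))"
    by (intro compact_continuous_image continuous_on_subset[OF assms] compact_Times) auto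
  then obtain C where "\<forall>y\<in>(\<lambda>(t, x). g t x) ` ({0..T} \<times> cball 0 r). \<bar>y\<bar> \<le> C"
    using bounded_real compact_imp_bounded by blast
  then show thesis
    by (intro that[of C]) force
qed

section \<open>The triangular system\<close>

locale triangular_system =
  fixes e :: "nat \<Rightarrow> 'n::finite"
    and f :: "nat \<Rightarrow> real \<Rightarrow> real^'n \<Rightarrow> real"
    and a :: "nat \<Rightarrow> real \<Rightarrow> real \<Rightarrow> real"
    and m :: "nat \<Rightarrow> nat"
  assumes e: "bij_betw e {1..CARD('n)} UNIV"
    and m_odd: "i \<in> {1..<CARD('n)} \<Longrightarrow> odd (m i)"
    and f_dep: "i \<in> {1..CARD('n)} \<Longrightarrow> depends_on_first e i (f i)"
    and f_C1: "i \<in> {1..CARD('n)} \<Longrightarrow> C1_on ({0..} \<times> UNIV) (\<lambda>(t, x). f i t x)"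
    and a_C1: "i \<in> {1..<CARD('n)} \<Longrightarrow> C1_on ({0..} \<times> UNIV) (\<lambda>(t, y). a i t y)"
    and a_nz: "i \<in> {1..<CARD('n)} \<Longrightarrow> 0 \<le> t \<Longrightarrow> a i t y \<noteq> 0"
begin

abbreviation field :: "real \<Rightarrow> real^'n \<Rightarrow> real^'n" where
  "field \<equiv> triangular_field e f a m"

lemma index_eq_iff: "i \<in> {1..CARD('n)} \<Longrightarrow> j \<in> {1..CARD('n)} \<Longrightarrow> e i = e j \<longleftrightarrow> i = j"
  using e by (auto simp: bij_betw_def inj_on_eq_iff)

lemma all_index: "(\<forall>k. P k) \<longleftrightarrow> (\<forall>i\<in>{1..CARD('n)}. P (e i))"
  using e unfolding bij_betw_def by (metis UNIV_I image_iff)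

lemma axis_index_nth:
  assumes "i \<in> {1..CARD('n)}" "j \<in> {1..CARD('n)}"
  shows "axis (e i) (c::real) $ e j = (if i = j then c else 0)"
  using index_eq_iff[OF assms] by (auto simp: axis_def)

lemma sum_axis_nth:
  assumes "j \<in> {1..CARD('n)}"
  shows "(\<Sum>i=1..CARD('n). axis (e i) (c i :: real)) $ e j = c j"
proof -
  have "(\<Sum>i=1..CARD('n). axis (e i) (c i)) $ e j = (\<Sum>i=1..CARD('n). if i = j then c i else 0)"
    unfolding sum_component using assms by (intro sum.cong) (auto simp: axis_index_nth)
  then show ?thesis
    using assms by (simp add: sum.delta)
qed

lemma field_nth:
  assumes "i \<in> {1..CARD('n)}"
  shows "field t x $ e i =
    f i t x + (if i < CARD('n) then a i t (x $ e 1) * (x $ e (i + 1)) ^ m i else 0)"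
  unfolding triangular_field_def sum_axis_nth[OF assms] ..

lemma f_continuous: "i \<in> {1..CARD('n)} \<Longrightarrow> continuous_on ({0..} \<times> UNIV) (\<lambda>(t, x). f i t x)"
  by (intro C1_on_imp_continuous_on f_C1)

lemma a_continuous: "i \<in> {1..<CARD('n)} \<Longrightarrow> continuous_on ({0..} \<times> UNIV) (\<lambda>(t, y). a i t y)"
  by (intro C1_on_imp_continuous_on a_C1)

lemma f_continuous_compose:
  assumes "i \<in> {1..CARD('n)}" "continuous_on S g" "continuous_on S h" "\<And>p. p \<in> S \<Longrightarrow> 0 \<le> g p"
  shows "continuous_on S (\<lambda>p. f i (g p) (h p))"
  using continuous_on_compose2[OF f_continuous[OF assms(1)] continuous_on_Pair[OF assms(2,3)]] assms(4)
  by auto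

lemma a_continuous_compose:
  assumes "i \<in> {1..<CARD('n)}" "continuous_on S g" "continuous_on S h" "\<And>p. p \<in> S \<Longrightarrow> 0 \<le> g p"
  shows "continuous_on S (\<lambda>p. a i (g p) (h p))"
  using continuous_on_compose2[OF a_continuous[OF assms(1)] continuous_on_Pair[OF assms(2,3)]] assms(4)
  by auto

lemma field_nth_continuous:
  assumes "i \<in> {1..CARD('n)}"
  shows "continuous_on ({0..} \<times> UNIV) (\<lambda>(t, x). field t x $ e i)"
  unfolding field_nth[OF assms] case_prod_beta using assms
  by (cases "i < CARD('n)")
    (auto intro!: continuous_intros f_continuous_compose a_continuous_compose)

lemma solution_nth:
  assumes "is_solution field J x" "t \<in> J"
  shows "((\<lambda>t. x t $ k) has_real_derivative field t (x t) $ k) (at t within J)"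
  using assms unfolding is_solution_def has_vector_derivative_cart by blast

text \<open>The second derivative of the \<open>i\<close>-th state along a trajectory is a continuous function of time
  and state, because the \<open>i\<close>-th component of the field is continuously differentiable and the
  first derivative of the state is the field itself.\<close>

lemma field_derivative:
  assumes i: "i \<in> {1..CARD('n)}"
  obtains H where "continuous_on ({0..} \<times> UNIV) (\<lambda>(t, x). H t x)"
    "\<And>s t x. 0 \<le> s \<Longrightarrow> s \<le> t \<Longrightarrow> is_solution field {s..} x \<Longrightarrow>
       ((\<lambda>t. field t (x t) $ e i) has_real_derivative H t (x t)) (at t within {s..})"
proof -
  obtain D where D: "continuous_on ({0..} \<times> UNIV \<times> UNIV) (\<lambda>(t, x, v). D t x v)"
    and Dd: "\<And>s t x v. 0 \<le> s \<Longrightarrow> s \<le> t \<Longrightarrow> (x has_vector_derivative v) (at t within {s..}) \<Longrightarrow>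
       ((\<lambda>t. f i t (x t)) has_real_derivative D t (x t) v) (at t within {s..})"
    by (rule C1_on_chain_rule[OF f_C1[OF i]]) (rule that)
  have vec: "continuous_on ({0..} \<times> UNIV) (\<lambda>p. field (fst p) (snd p))"
    using field_nth_continuous all_index[of "\<lambda>k. continuous_on ({0..} \<times> UNIV) (\<lambda>p. field (fst p) (snd p) $ k)"]
    by (subst continuous_on_componentwise) (auto simp: Basis_vec_def inner_axis case_prod_beta)
  have cD: "continuous_on ({0..} \<times> UNIV) (\<lambda>(t, x). D t x (field t x))"
    unfolding case_prod_beta
    by (rule continuous_on_compose_triple[OF D]) (auto intro!: continuous_intros vec)
  show thesis
  proof (cases "i < CARD('n)")
    case False
    show thesis
    proof (rule that[OF cD])
      fix s t x assume st: "0 \<le> s" "s \<le> t" and "is_solution field {s..} x"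
      then have "(x has_vector_derivative field t (x t)) (at t within {s..})"
        by (auto simp: is_solution_def)
      then show "((\<lambda>t. field t (x t) $ e i) has_real_derivative D t (x t) (field t (x t))) (at t within {s..})"
        unfolding field_nth[OF i] using False by (simp add: Dd st)
    qed
  next
    case True
    then have i': "i \<in> {1..<CARD('n)}" "Suc i \<in> {1..CARD('n)}"
      using i by auto
    obtain E where E: "continuous_on ({0..} \<times> UNIV \<times> UNIV) (\<lambda>(t, y, v). E t y v)"
      and Ed: "\<And>s t y v. 0 \<le> s \<Longrightarrow> s \<le> t \<Longrightarrow> (y has_vector_derivative v) (at t within {s..}) \<Longrightarrow>
         ((\<lambda>t. a i t (y t)) has_real_derivative E t (y t) v) (at t within {s..})"
      by (rule C1_on_chain_rule[OF a_C1[OF i'(1)]]) (rule that)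
    have cE: "continuous_on ({0..} \<times> UNIV) (\<lambda>(t, x). E t (x $ e 1) (field t x $ e 1))"
      unfolding case_prod_beta
      by (rule continuous_on_compose_triple[OF E]) (auto intro!: continuous_intros vec)
    define H where "H t x = D t x (field t x) + (E t (x $ e 1) (field t x $ e 1) * (x $ e (i + 1)) ^ m i +
        a i t (x $ e 1) * (real (m i) * (x $ e (i + 1)) ^ (m i - 1) * field t x $ e (i + 1)))" for t x
    show thesis
    proof (rule that[of H])
      show "continuous_on ({0..} \<times> UNIV) (\<lambda>(t, x). H t x)"
        using cD cE unfolding H_def case_prod_beta
        by (intro continuous_intros a_continuous_compose[OF i'(1)] vec) auto
      fix s t x assume st: "0 \<le> s" "s \<le> t" and x: "is_solution field {s..} x"
      have nth: "((\<lambda>t. x t $ k) has_real_derivative field t (x t) $ k) (at t within {s..})" for k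
        using solution_nth[OF x, of t] st by simp
      have d1: "((\<lambda>t. f i t (x t)) has_real_derivative D t (x t) (field t (x t))) (at t within {s..})"
        using x st by (intro Dd) (auto simp: is_solution_def)
      have d2: "((\<lambda>t. a i t (x t $ e 1)) has_real_derivative E t (x t $ e 1) (field t (x t) $ e 1))
          (at t within {s..})"
        using st nth by (intro Ed) (auto simp flip: has_real_derivative_iff_has_vector_derivative)
      show "((\<lambda>t. field t (x t) $ e i) has_real_derivative H t (x t)) (at t within {s..})"
        unfolding field_nth[OF i] H_def using True
        by (auto intro!: derivative_eq_intros d1 d2[unfolded One_nat_def] nth)
    qed
  qed
qed

section \<open>The observer\<close>

text \<open>The vector with the estimates of the first \<open>i\<close> states as its first \<open>i\<close> coordinates, and 0 in
  the other places. The estimate of \<open>x\<^sub>i\<^sub>+\<^sub>1\<close> solves the \<open>i\<close>-th equation of the system for \<open>x\<^sub>i\<^sub>+\<^sub>1\<close>, with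
  the derivative of \<open>x\<^sub>i\<close> replaced by \<open>K\<^sub>i\<close> times the difference of the \<open>i\<close>-th estimate and \<open>z\<^sub>i\<close>.\<close>

primrec estimate :: "(nat \<Rightarrow> real \<Rightarrow> real) \<Rightarrow> nat \<Rightarrow> real \<Rightarrow> real^'n \<Rightarrow> real \<Rightarrow> real^'n" where
  "estimate K 0 t z y = 0"
| "estimate K (Suc i) t z y = estimate K i t z y + axis (e (Suc i))
     (if i = 0 then y
      else root (m i) ((K i t * (estimate K i t z y $ e i - z $ e i) - f i t (estimate K i t z y)) / a i t y))"

definition observer ::
    "(nat \<Rightarrow> real \<Rightarrow> real) \<Rightarrow> (nat \<Rightarrow> real \<Rightarrow> real) \<Rightarrow> real \<Rightarrow> real^'n \<Rightarrow> real \<Rightarrow> real^'n" where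
  "observer K K' t z y =
     (\<Sum>i=1..CARD('n). axis (e i) ((K i t + K' i t / K i t) * (estimate K i t z y $ e i - z $ e i)))"

text \<open>This gives the observer its cascade structure: the input of the \<open>i\<close>-th filter involves only the
  states of the preceding filters.\<close>

lemma estimate_causal:
  assumes "i \<le> CARD('n)" "\<And>j. j \<in> {1..<i} \<Longrightarrow> z $ e j = z' $ e j"
  shows "estimate K i t z y = estimate K i t z' y"
  using assms
proof (induction i)
  case (Suc i)
  then have "estimate K i t z y = estimate K i t z' y"
    by simp
  moreover have "z $ e i = z' $ e i" if "i \<noteq> 0"
    using Suc.prems that by simp
  ultimately show ?case
    by simp
qed simp

lemma estimate_continuous:
  assumes K: "\<And>i. continuous_on {0..} (K i)" and "i \<le> CARD('n)"
  shows "continuous_on ({0..} \<times> UNIV \<times> UNIV) (\<lambda>(t, z, y). estimate K i t z y)"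
  using assms(2)
proof (induction i)
  case (Suc i)
  then have IH: "continuous_on ({0..} \<times> UNIV \<times> UNIV) (\<lambda>p. estimate K i (fst p) (fst (snd p)) (snd (snd p)))"
    by (simp add: case_prod_beta)
  show ?case
  proof (cases "i = 0")
    case True
    then show ?thesis
      by (auto simp: case_prod_beta intro!: continuous_intros continuous_on_axis)
  next
    case False
    with Suc.prems have i: "i \<in> {1..<CARD('n)}" "i \<in> {1..CARD('n)}"
      by auto
    have "continuous_on ({0..} \<times> UNIV \<times> UNIV) (\<lambda>p. K i (fst p))"
      by (intro continuous_on_compose2[OF K] continuous_intros) auto
    then show ?thesis
      using False i(1) unfolding estimate.simps case_prod_beta
      by (auto intro!: continuous_intros continuous_on_axis IH f_continuous_compose[OF i(2)]
          a_continuous_compose[OF i(1)] simp: a_nz simp del: UNIV_Times_UNIV)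
  qed
qed (simp add: case_prod_beta)

lemma observer_continuous:
  assumes K: "\<And>i. weight (K i) (K' i)"
  shows "continuous_on ({0..} \<times> UNIV \<times> UNIV) (\<lambda>(t, z, y). observer K K' t z y)"
proof -
  have 1: "continuous_on ({0..} \<times> UNIV \<times> UNIV) (\<lambda>p. K i (fst p))"
    "continuous_on ({0..} \<times> UNIV \<times> UNIV) (\<lambda>p. K' i (fst p))" for i
    by (rule continuous_on_compose2[OF weightD(3)[OF K, where S = UNIV]]
        continuous_on_compose2[OF weightD(2)[OF K, where S = UNIV]];
        intro continuous_intros subset_UNIV)+
  have 2: "K i t \<noteq> 0" for i t
    using weightD(5)[OF K, of i t] by simp
  have "continuous_on ({0..} \<times> UNIV \<times> UNIV)
      (\<lambda>p. estimate K i (fst p) (fst (snd p)) (snd (snd p)))" if "i \<in> {1..CARD('n)}" for i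
    using estimate_continuous[of K i] weightD(3)[OF K] that by (auto simp: case_prod_beta)
  then show ?thesis
    unfolding observer_def case_prod_beta
    by (intro continuous_intros continuous_on_axis 1) (auto simp: 2)
qed

lemma observer_nth:
  "i \<in> {1..CARD('n)} \<Longrightarrow> observer K K' t z y $ e i =
    (K i t + K' i t / K i t) * (estimate K i t z y $ e i - z $ e i)"
  unfolding observer_def by (rule sum_axis_nth)

lemma observer_solution_iff:
  "is_solution (\<lambda>t z. observer K K' t z (y t)) J z \<longleftrightarrow>
    (\<forall>i\<in>{1..CARD('n)}. \<forall>t\<in>J. ((\<lambda>t. z t $ e i) has_real_derivative
       (K i t + K' i t / K i t) * (estimate K i t (z t) (y t) $ e i - z t $ e i)) (at t within J))"
  unfolding is_solution_def has_vector_derivative_cart all_index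
  by (auto simp: observer_nth)

lemma filter_rate_continuous:
  assumes "\<And>i. weight (K i) (K' i)"
  shows "continuous_on S (\<lambda>t. K i t + K' i t / K i t)"
proof -
  have "K i t \<noteq> 0" for t
    using weightD(5)[OF assms, of i t] by simp
  then show ?thesis
    by (intro continuous_intros weightD[OF assms]) auto
qed

text \<open>The filters are solved one after the other. Each is a scalar linear equation with a continuous
  input computed from the output and the filters solved before.\<close>

lemma observer_solution:
  assumes K: "\<And>i. weight (K i) (K' i)" and s: "0 \<le> s" and y: "continuous_on {s..} y"
  obtains z where "is_solution (\<lambda>t z. observer K K' t z (y t)) {s..} z" "z s = 0"
proof -
  have "\<exists>z. continuous_on {s..} z \<and> z s = 0 \<and>
    (\<forall>j\<in>{1..i}. \<forall>t\<in>{s..}. ((\<lambda>t. z t $ e j) has_real_derivative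
       (K j t + K' j t / K j t) * (estimate K j t (z t) (y t) $ e j - z t $ e j)) (at t within {s..}))"
    if "i \<le> CARD('n)" for i
    using that
  proof (induction i)
    case 0
    show ?case
      by (rule exI[of _ "\<lambda>_. 0"]) auto
  next
    case (Suc i)
    then obtain z where z: "continuous_on {s..} z" "z s = 0" and
      dz: "\<And>j t. j \<in> {1..i} \<Longrightarrow> t \<in> {s..} \<Longrightarrow> ((\<lambda>t. z t $ e j) has_real_derivative
         (K j t + K' j t / K j t) * (estimate K j t (z t) (y t) $ e j - z t $ e j)) (at t within {s..})"
      by auto
    define u where "u t = estimate K (Suc i) t (z t) (y t) $ e (Suc i)" for t
    have "continuous_on ({0..} \<times> UNIV \<times> UNIV) (\<lambda>(t, z, y). estimate K (Suc i) t z y)"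
      using Suc.prems by (intro estimate_continuous weightD[OF K])
    then have "continuous_on {s..} (\<lambda>t. estimate K (Suc i) t (z t) (y t))"
      by (rule continuous_on_compose_triple) (use s z y in \<open>auto intro!: continuous_intros\<close>)
    then have "continuous_on {s..} u"
      unfolding u_def by (intro continuous_intros)
    then obtain \<zeta> where \<zeta>: "\<zeta> s = 0"
      "\<And>t. s \<le> t \<Longrightarrow> (\<zeta> has_real_derivative (K (Suc i) t + K' (Suc i) t / K (Suc i) t) * (u t - \<zeta> t))
          (at t within {s..})"
      using linear_ode_solution[OF filter_rate_continuous[OF K]] by metis
    define z' where "z' t = z t + axis (e (Suc i)) (\<zeta> t - z t $ e (Suc i))" for t
    have nth: "z' t $ e j = (if j = Suc i then \<zeta> t else z t $ e j)" if "j \<in> {1..CARD('n)}" for j t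
      using that Suc.prems by (simp add: z'_def axis_index_nth)
    have est: "estimate K j t (z' t) (y t) = estimate K j t (z t) (y t)" if "j \<in> {1..Suc i}" for j t
      using that Suc.prems by (intro estimate_causal) (auto simp: nth)
    show ?case
    proof (intro exI[of _ z'] conjI ballI)
      have "continuous_on {s..} \<zeta>"
        using \<zeta>(2) by (intro DERIV_continuous_on) auto
      then show "continuous_on {s..} z'"
        unfolding z'_def using z by (intro continuous_intros continuous_on_axis)
      show "z' s = 0"
        using z \<zeta> by (simp add: z'_def)
      fix j t assume j: "j \<in> {1..Suc i}" and t: "t \<in> {s..}"
      then have j': "j \<in> {1..CARD('n)}"
        using Suc.prems by auto
      show "((\<lambda>t. z' t $ e j) has_real_derivative
          (K j t + K' j t / K j t) * (estimate K j t (z' t) (y t) $ e j - z' t $ e j)) (at t within {s..})"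
        unfolding est[OF j] nth[OF j'] using dz[of j t] \<zeta>(2)[of t] j t
        by (cases "j = Suc i") (auto simp: u_def simp del: estimate.simps)
    qed
  qed
  from this[OF order_refl] that show thesis
    unfolding observer_solution_iff by metis
qed

lemma observer_unique:
  assumes K: "\<And>i. weight (K i) (K' i)"
    and J: "J \<subseteq> {s..}" "\<And>t. t \<in> J \<Longrightarrow> {s..t} \<subseteq> J"
    and z: "is_solution (\<lambda>t z. observer K K' t z (y t)) J z"
    and z': "is_solution (\<lambda>t z. observer K K' t z (y t)) J z'"
    and eq: "z s = z' s" and t: "t \<in> J"
  shows "z t = z' t"
proof -
  have "\<forall>r\<in>J. z r $ e i = z' r $ e i" if "i \<in> {1..CARD('n)}" for i
    using that
  proof (induction i rule: less_induct)
    case (less i)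
    show ?case
    proof
      fix r assume r: "r \<in> J"
      have est: "estimate K i q (z q) (y q) = estimate K i q (z' q) (y q)" if "q \<in> J" for q
        using less that by (intro estimate_causal) auto
      show "z r $ e i = z' r $ e i"
      proof (rule linear_ode_unique[OF filter_rate_continuous[OF K],
            where z = "\<lambda>t. z t $ e i" and z' = "\<lambda>t. z' t $ e i" and s = s])
        show "s \<le> r"
          using r J by auto
        fix q assume q: "q \<in> {s..r}"
        then have "q \<in> J"
          using J(2)[OF r] by auto
        then show "((\<lambda>t. z t $ e i) has_real_derivative (K i q + K' i q / K i q) *
            (estimate K i q (z q) (y q) $ e i - z q $ e i)) (at q within {s..r})"
          using z less.prems J(2)[OF r] unfolding observer_solution_iff by (blast intro: DERIV_subset)
        show "((\<lambda>t. z' t $ e i) has_real_derivative (K i q + K' i q / K i q) *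
            (estimate K i q (z q) (y q) $ e i - z' q $ e i)) (at q within {s..r})"
          unfolding est[OF \<open>q \<in> J\<close>] using \<open>q \<in> J\<close>
          using z' less.prems J(2)[OF r] unfolding observer_solution_iff by (blast intro: DERIV_subset)
      qed (simp add: eq)
    qed
  qed
  then show ?thesis
    using t by (simp add: vec_eq_iff all_index)
qed

lemma observer_solution_exists_on:
  assumes K: "\<And>i. weight (K i) (K' i)" and s: "0 \<le> s" and y: "continuous_on {s..} y"
    and J: "J \<subseteq> {s..}"
  shows "solution_exists_on (\<lambda>t z. observer K K' t z (y t)) J s 0"
proof -
  obtain z where z: "is_solution (\<lambda>t z. observer K K' t z (y t)) {s..} z" "z s = 0"
    by (rule observer_solution[OF K s y]) (rule that)
  have sub: "is_solution (\<lambda>t z. observer K K' t z (y t)) I z" if "I \<subseteq> {s..}" for I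
    using z(1) that by (rule is_solution_subset)
  show ?thesis
    unfolding solution_exists_on_def
  proof (intro conjI allI impI)
    show "\<exists>z. is_solution (\<lambda>t z. observer K K' t z (y t)) J z \<and> z s = 0"
      using sub[OF J] z(2) by blast
    fix T z' assume *: "s < T \<and> {s..<T} \<subseteq> J \<and>
      is_solution (\<lambda>t z. observer K K' t z (y t)) {s..<T} z' \<and> z' s = 0"
    have "z t = z' t" if "t \<in> {s..<T}" for t
      by (rule observer_unique[OF K, where J = "{s..<T}" and s = s and y = y])
         (use * that z(2) in \<open>auto intro!: sub\<close>)
    then show "\<exists>x'. is_solution (\<lambda>t z. observer K K' t z (y t)) J x' \<and> (\<forall>t\<in>{s..<T}. x' t = z' t)"
      using sub[OF J] by blast
  qed
qed

end

section \<open>The choice of the gains\<close>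

text \<open>The conditions that link two consecutive filters. The error of the estimate with index \<open>i + 1\<close> is
  to vanish with weight \<open>V\<close>, the error of the estimates up to index \<open>i\<close> vanishes with weight \<open>W\<close>, and \<open>B\<close>
  bounds the data of the system. A \<open>k\<close>-th root being Hoelder continuous of exponent \<open>1/k\<close>, the radicand
  must be accurate with weight \<open>V\<^sup>k\<close>. It contains a division by \<open>a\<^sub>i\<close>, which costs a factor \<open>B\<close>, so that
  \<open>\<Omega>\<close> is the weight needed for the derivative estimate. The factor \<open>1 + t\<close> makes the second derivative,
  bounded by \<open>B\<close>, negligible against the gain; \<open>W\<close> collects the factors by which errors of the first
  \<open>i\<close> estimates get multiplied.\<close>

definition gain_stage ::
    "(real \<Rightarrow> real) \<Rightarrow> nat \<Rightarrow> (real \<Rightarrow> real) \<Rightarrow> (real \<Rightarrow> real) \<Rightarrow> (real \<Rightarrow> real) \<Rightarrow> (real \<Rightarrow> real) \<Rightarrow> bool" where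
  "gain_stage B k V K K' W \<longleftrightarrow>
     (\<exists>\<Omega> \<Omega>'. weight \<Omega> \<Omega>' \<and>
        (\<forall>t\<ge>0. V t ^ k * B t \<le> \<Omega> t \<and> 2 * \<bar>\<Omega>' t\<bar> \<le> K t \<and> (1 + t) * (\<Omega> t * B t) \<le> K t \<and>
           W t = V t + \<Omega> t * ((K t)\<^sup>2 + \<bar>K' t\<bar> + B t)))"

lemma gain_stage_exists:
  assumes B: "weight B B'" and V: "continuous_on {0..} V" "\<And>t. 0 \<le> t \<Longrightarrow> 1 \<le> V t"
  obtains K K' W where "gain_stage B k V K K' W" "weight K K'" "continuous_on {0..} W"
    "\<And>t. 0 \<le> t \<Longrightarrow> 1 \<le> W t"
proof -
  have "continuous_on {0..} (\<lambda>t. V t ^ k * B t)"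
    by (intro continuous_intros V weightD[OF B])
  then obtain \<Omega> \<Omega>' where \<Omega>: "weight \<Omega> \<Omega>'" "\<And>t. 0 \<le> t \<Longrightarrow> V t ^ k * B t \<le> \<Omega> t"
    by (rule weight_majorant_continuous) (rule that)
  have "continuous_on {0..} (\<lambda>t. 2 * \<bar>\<Omega>' t\<bar> + (1 + t) * (\<Omega> t * B t))"
    by (intro continuous_intros weightD[OF B] weightD[OF \<Omega>(1)])
  then obtain K K' where K: "weight K K'"
    "\<And>t. 0 \<le> t \<Longrightarrow> 2 * \<bar>\<Omega>' t\<bar> + (1 + t) * (\<Omega> t * B t) \<le> K t"
    by (rule weight_majorant_continuous) (rule that)
  define W where "W t = V t + \<Omega> t * ((K t)\<^sup>2 + \<bar>K' t\<bar> + B t)" for t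
  have nonneg: "0 \<le> \<Omega> t * B t" "0 \<le> \<Omega> t * ((K t)\<^sup>2 + \<bar>K' t\<bar> + B t)" for t
    using weightD(5)[OF \<Omega>(1), of t] weightD(5)[OF B, of t] by simp_all
  show thesis
  proof (rule that)
    have "2 * \<bar>\<Omega>' t\<bar> \<le> K t \<and> (1 + t) * (\<Omega> t * B t) \<le> K t" if "0 \<le> t" for t
      using K(2)[OF that] mult_nonneg_nonneg[of "1 + t", OF _ nonneg(1)[of t]] that by linarith
    then show "gain_stage B k V K K' W"
      unfolding gain_stage_def using \<Omega> by (auto simp: W_def)
    show "continuous_on {0..} W"
      unfolding W_def by (intro continuous_intros V weightD[OF B] weightD[OF \<Omega>(1)] weightD[OF K(1)])
    show "1 \<le> W t" if "0 \<le> t" for t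
      using V(2)[OF that] nonneg(2)[of t] by (simp add: W_def)
  qed (rule K(1))
qed

text \<open>Every stage refers to the weight of the next one, so the stages are chosen in the order
  \<open>n, \<dots>, 1\<close>. Beyond stage \<open>n\<close> there is no accuracy to provide, and the weight is 1.\<close>

lemma gain_sequence:
  assumes B: "weight B B'"
  obtains K K' W where "\<And>i. weight (K i) (K' i)" "\<And>i t. 0 \<le> t \<Longrightarrow> 1 \<le> W i t"
    "\<And>i. i \<in> {1..n} \<Longrightarrow> gain_stage B (k i) (W (Suc i)) (K i) (K' i) (W i)"
proof -
  define P where "P d \<longleftrightarrow> (case d of (W, K, K') \<Rightarrow> weight K K' \<and> continuous_on {0..} W \<and> (\<forall>t\<ge>0. 1 \<le> W t))"
    for d :: "(real \<Rightarrow> real) \<times> (real \<Rightarrow> real) \<times> (real \<Rightarrow> real)"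
  define Q where "Q j c d \<longleftrightarrow> (case d of (W, K, K') \<Rightarrow> gain_stage B (k (n - j)) (fst c) K K' W)"
    for j and c d :: "(real \<Rightarrow> real) \<times> (real \<Rightarrow> real) \<times> (real \<Rightarrow> real)"
  \<comment> \<open>The weight of stage \<open>n - j\<close> is built from that of stage \<open>n - j + 1\<close>: the choice runs backwards.\<close>
  have "\<exists>g. \<forall>j. P (g j) \<and> Q j (g j) (g (Suc j))"
  proof (rule dependent_nat_choice)
    show "\<exists>d. P d"
      by (rule exI[of _ "(\<lambda>_. 1, B, B')"]) (simp add: P_def B)
    fix c j assume "P c"
    then have c: "continuous_on {0..} (fst c)" "\<And>t. 0 \<le> t \<Longrightarrow> 1 \<le> fst c t"
      by (auto simp: P_def)
    obtain K K' W where "gain_stage B (k (n - j)) (fst c) K K' W" "weight K K'"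
      "continuous_on {0..} W" "\<And>t. 0 \<le> t \<Longrightarrow> 1 \<le> W t"
      using gain_stage_exists[OF B c(1), of "k (n - j)"] c(2) by blast
    then show "\<exists>d. P d \<and> Q j c d"
      by (intro exI[of _ "(W, K, K')"]) (auto simp: P_def Q_def)
  qed
  then obtain g where g: "\<And>j. P (g j)" "\<And>j. Q j (g j) (g (Suc j))"
    by blast
  show thesis
  proof (rule that)
    show "weight (fst (snd (g (Suc n - i)))) (snd (snd (g (Suc n - i))))" for i
      using g(1)[of "Suc n - i"] by (auto simp: P_def)
    show "1 \<le> fst (g (Suc n - i)) t" if "0 \<le> t" for i t
      using g(1)[of "Suc n - i"] that by (auto simp: P_def)
    show "gain_stage B (k i) (fst (g (Suc n - Suc i))) (fst (snd (g (Suc n - i))))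
        (snd (snd (g (Suc n - i)))) (fst (g (Suc n - i)))" if "i \<in> {1..n}" for i
      using g(2)[of "n - i"] that by (auto simp: Q_def Suc_diff_le)
  qed
qed

section \<open>Convergence of the observer\<close>

locale bounded_triangular_system = triangular_system e f a m
  for e :: "nat \<Rightarrow> 'n::finite"
    and f :: "nat \<Rightarrow> real \<Rightarrow> real^'n \<Rightarrow> real"
    and a :: "nat \<Rightarrow> real \<Rightarrow> real \<Rightarrow> real"
    and m :: "nat \<Rightarrow> nat" +
  fixes \<beta> :: "real \<Rightarrow> real \<Rightarrow> real"
  assumes \<beta>_mono: "0 \<le> t \<Longrightarrow> t \<le> t' \<Longrightarrow> 0 \<le> r \<Longrightarrow> r \<le> r' \<Longrightarrow> \<beta> t r \<le> \<beta> t' r'"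
    and bound: "0 \<le> s \<Longrightarrow> is_solution field {s..} x \<Longrightarrow> s \<le> t \<Longrightarrow> norm (x t) \<le> \<beta> t (norm (x s))"
begin

definition first_coords :: "nat \<Rightarrow> real^'n \<Rightarrow> real^'n" where
  "first_coords i x = (\<Sum>j=1..i. axis (e j) (x $ e j))"

lemma first_coords_nth:
  assumes "j \<in> {1..CARD('n)}" "i \<le> CARD('n)"
  shows "first_coords i x $ e j = (if j \<le> i then x $ e j else 0)"
proof -
  have "first_coords i x $ e j = (\<Sum>l=1..i. if l = j then x $ e l else 0)"
    unfolding first_coords_def sum_component using assms
    by (intro sum.cong) (auto simp: axis_index_nth)
  then show ?thesis
    using assms by (simp add: sum.delta)
qed

lemma norm_first_coords_le: "i \<le> CARD('n) \<Longrightarrow> norm (first_coords i x) \<le> norm x"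
  by (rule norm_le_componentwise_cart, rule all_index[THEN iffD2, rule_format])
    (simp add: first_coords_nth)

text \<open>Estimates of the first \<open>i\<close> states are compared with the truncated state, so that the unknown
  remaining coordinates do not enter the error.\<close>

lemma f_first_coords:
  "i \<in> {1..CARD('n)} \<Longrightarrow> 0 \<le> t \<Longrightarrow> f i t (first_coords i x) = f i t x"
  using f_dep[of i] unfolding depends_on_first_def by (auto simp: first_coords_nth)

text \<open>A trajectory with \<open>\<bar>x\<bar> \<le> \<beta>(t, R)\<close> lies in the ball of radius \<open>\<beta>(t, t)\<close> from time \<open>R\<close> on, and its
  estimates eventually have distance at most 1 from it. Bounds over the balls of radius \<open>\<beta>(t, t) + 1\<close>
  are therefore enough, whatever the initial value. \<open>H\<close> is the second derivative of the states.\<close>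

lemma system_majorant:
  obtains H B B' where "weight B B'"
    "\<And>i. i \<in> {1..CARD('n)} \<Longrightarrow> continuous_on ({0..} \<times> UNIV) (\<lambda>(t, x). H i t x)"
    "\<And>i s t x. i \<in> {1..CARD('n)} \<Longrightarrow> 0 \<le> s \<Longrightarrow> s \<le> t \<Longrightarrow> is_solution field {s..} x \<Longrightarrow>
       ((\<lambda>t. field t (x t) $ e i) has_real_derivative H i t (x t)) (at t within {s..})"
    "\<And>i t x x'. i \<in> {1..CARD('n)} \<Longrightarrow> 0 \<le> t \<Longrightarrow> norm x \<le> \<beta> t t + 1 \<Longrightarrow> norm x' \<le> \<beta> t t + 1 \<Longrightarrow>
       \<bar>field t x $ e i\<bar> \<le> B t \<and> \<bar>H i t x\<bar> \<le> B t \<and> \<bar>f i t x - f i t x'\<bar> \<le> B t * norm (x - x') \<and>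
       (i < CARD('n) \<longrightarrow> 1 / \<bar>a i t (x $ e 1)\<bar> \<le> B t)"
proof -
  have "\<forall>i\<in>{1..CARD('n)}. \<exists>H. continuous_on ({0..} \<times> UNIV) (\<lambda>(t, x). H t x) \<and>
    (\<forall>s t x. 0 \<le> s \<longrightarrow> s \<le> t \<longrightarrow> is_solution field {s..} x \<longrightarrow>
       ((\<lambda>t. field t (x t) $ e i) has_real_derivative H t (x t)) (at t within {s..}))"
  proof
    fix i assume i: "i \<in> {1..CARD('n)}"
    show "\<exists>H. continuous_on ({0..} \<times> UNIV) (\<lambda>(t, x). H t x) \<and>
    (\<forall>s t x. 0 \<le> s \<longrightarrow> s \<le> t \<longrightarrow> is_solution field {s..} x \<longrightarrow>
       ((\<lambda>t. field t (x t) $ e i) has_real_derivative H t (x t)) (at t within {s..}))"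
      by (rule field_derivative[OF i]) blast
  qed
  from bchoice[OF this] obtain H where H: "\<And>i. i \<in> {1..CARD('n)} \<Longrightarrow>
      continuous_on ({0..} \<times> UNIV) (\<lambda>(t, x). H i t x)"
    "\<And>i s t x. i \<in> {1..CARD('n)} \<Longrightarrow> 0 \<le> s \<Longrightarrow> s \<le> t \<Longrightarrow> is_solution field {s..} x \<Longrightarrow>
       ((\<lambda>t. field t (x t) $ e i) has_real_derivative H i t (x t)) (at t within {s..})"
    by blast
  define h where "h i t x x' = \<bar>field t x $ e i\<bar> + \<bar>H i t x\<bar> + \<bar>f i t x - f i t x'\<bar> / norm (x - x') +
    (if i < CARD('n) then \<bar>1 / a i t (x $ e 1)\<bar> else 0)" for i t x x'
  have h_nonneg: "0 \<le> h i t x x'" for i t x x'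
    by (simp add: h_def)
  have h_bound: "\<exists>C. \<forall>t x x'. 0 \<le> t \<and> t \<le> T \<and> norm x \<le> r \<and> norm x' \<le> r \<longrightarrow> h i t x x' \<le> C"
    if i: "i \<in> {1..CARD('n)}" for i T r
  proof -
    obtain C1 where C1: "\<And>t x. 0 \<le> t \<Longrightarrow> t \<le> T \<Longrightarrow> norm x \<le> r \<Longrightarrow> \<bar>field t x $ e i\<bar> \<le> C1"
      using continuous_bounded_on_cball[OF field_nth_continuous[OF i], of T r] by metis
    obtain C2 where C2: "\<And>t x. 0 \<le> t \<Longrightarrow> t \<le> T \<Longrightarrow> norm x \<le> r \<Longrightarrow> \<bar>H i t x\<bar> \<le> C2"
      using continuous_bounded_on_cball[OF H(1)[OF i], of T r] by metis
    obtain L where L: "\<And>t x x'. 0 \<le> t \<Longrightarrow> t \<le> T \<Longrightarrow> norm x \<le> r \<Longrightarrow> norm x' \<le> r \<Longrightarrow>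
        \<bar>f i t x - f i t x'\<bar> \<le> L * norm (x - x')"
      using C1_on_lipschitz_on_cball[OF f_C1[OF i], of T r] by metis
    have L': "\<bar>f i t x - f i t x'\<bar> / norm (x - x') \<le> \<bar>L\<bar>"
      if "0 \<le> t" "t \<le> T" "norm x \<le> r" "norm x' \<le> r" for t x x'
    proof (cases "x = x'")
      case False
      have "\<bar>f i t x - f i t x'\<bar> / norm (x - x') \<le> L"
        using L[OF that] False by (simp add: pos_divide_le_eq)
      then show ?thesis by simp
    qed simp
    obtain C4 where C4: "\<And>t x. 0 \<le> t \<Longrightarrow> t \<le> T \<Longrightarrow> norm x \<le> r \<Longrightarrow>
      (if i < CARD('n) then \<bar>1 / a i t (x $ e 1)\<bar> else 0) \<le> C4"
    proof (cases "i < CARD('n)")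
      case True
      then have i': "i \<in> {1..<CARD('n)}"
        using i by auto
      have "continuous_on ({0..} \<times> UNIV) (\<lambda>(t, x). 1 / a i t (x $ e 1))"
        unfolding case_prod_beta using a_nz[OF i']
        by (intro continuous_intros a_continuous_compose[OF i']) auto
      from continuous_bounded_on_cball[OF this, of T r] that True show thesis
        by metis
    qed (use that[of 0] in simp)
    show ?thesis
      by (intro exI[of _ "C1 + C2 + \<bar>L\<bar> + C4"] allI impI)
         (unfold h_def, intro add_mono C1 C2 L' C4, auto)
  qed
  define D where "D = {(t, x, x'). norm (x :: real^'n) \<le> \<beta> t t + 1 \<and> norm (x' :: real^'n) \<le> \<beta> t t + 1}"
  have "\<exists>C. \<forall>(t, q)\<in>D. 0 \<le> t \<and> t \<le> T \<longrightarrow> (\<lambda>(x, x'). \<Sum>i=1..CARD('n). h i t x x') q \<le> C" for T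
  proof -
    have "\<forall>i\<in>{1..CARD('n)}. \<exists>C. \<forall>t x x'. 0 \<le> t \<and> t \<le> T \<and> norm x \<le> \<beta> T T + 1 \<and>
        norm x' \<le> \<beta> T T + 1 \<longrightarrow> h i t x x' \<le> C"
      using h_bound by blast
    from bchoice[OF this] obtain C where C: "\<And>i t x x'. i \<in> {1..CARD('n)} \<Longrightarrow> 0 \<le> t \<Longrightarrow> t \<le> T \<Longrightarrow>
        norm x \<le> \<beta> T T + 1 \<Longrightarrow> norm x' \<le> \<beta> T T + 1 \<Longrightarrow> h i t x x' \<le> C i"
      by blast
    have "(\<Sum>i=1..CARD('n). h i t x x') \<le> (\<Sum>i=1..CARD('n). C i)"
      if "(t, x, x') \<in> D" "0 \<le> t" "t \<le> T" for t x x'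
      using that \<beta>_mono[of t T t T] by (intro sum_mono C) (auto simp: D_def)
    then show ?thesis
      by (intro exI[of _ "\<Sum>i=1..CARD('n). C i"]) auto
  qed
  from weight_majorant[OF this] obtain B B' where B: "weight B B'"
    "\<And>t q. (t, q) \<in> D \<Longrightarrow> 0 \<le> t \<Longrightarrow> (\<lambda>(x, x'). \<Sum>i=1..CARD('n). h i t x x') q \<le> B t"
    by blast
  show thesis
  proof (rule that[OF B(1) H])
    fix i t and x x' :: "real^'n"
    assume i: "i \<in> {1..CARD('n)}" and t: "0 \<le> t" and x: "norm x \<le> \<beta> t t + 1" "norm x' \<le> \<beta> t t + 1"
    have "h i t x x' \<le> (\<Sum>i=1..CARD('n). h i t x x')"
      using i by (intro member_le_sum h_nonneg) auto
    also have "\<dots> \<le> B t"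
      using B(2)[of t "(x, x')"] t x by (auto simp: D_def)
    finally have le: "h i t x x' \<le> B t" .
    have a_part: "0 \<le> (if i < CARD('n) then \<bar>1 / a i t (x $ e 1)\<bar> else 0)"
      by simp
    have lip: "\<bar>f i t x - f i t x'\<bar> \<le> B t * norm (x - x')"
    proof (cases "x = x'")
      case False
      have "\<bar>f i t x - f i t x'\<bar> / norm (x - x') \<le> B t"
        using le a_part unfolding h_def by linarith
      then show ?thesis
        using False by (simp add: pos_divide_le_eq)
    qed simp
    have nn: "0 \<le> \<bar>f i t x - f i t x'\<bar> / norm (x - x')"
      by simp
    show "\<bar>field t x $ e i\<bar> \<le> B t \<and> \<bar>H i t x\<bar> \<le> B t \<and> \<bar>f i t x - f i t x'\<bar> \<le> B t * norm (x - x') \<and>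
       (i < CARD('n) \<longrightarrow> 1 / \<bar>a i t (x $ e 1)\<bar> \<le> B t)"
    proof (intro conjI impI lip)
      show "\<bar>field t x $ e i\<bar> \<le> B t" "\<bar>H i t x\<bar> \<le> B t"
        using le nn a_part unfolding h_def by linarith+
      show "1 / \<bar>a i t (x $ e 1)\<bar> \<le> B t" if "i < CARD('n)"
      proof -
        have "h i t x x' = \<bar>field t x $ e i\<bar> + \<bar>H i t x\<bar> + \<bar>f i t x - f i t x'\<bar> / norm (x - x') +
            1 / \<bar>a i t (x $ e 1)\<bar>"
          using that by (simp add: h_def)
        then show ?thesis
          using le nn by linarith
      qed
    qed
  qed
qed

text \<open>A trajectory of the system bounded by \<open>\<beta>(\<cdot>, R)\<close>, paired with the trajectory of the observer that it
  drives from time \<open>s\<close> on. The common initial value 0 of the observers keeps their transients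
  uniformly bounded.\<close>

definition observed :: "(nat \<Rightarrow> real \<Rightarrow> real) \<Rightarrow> (nat \<Rightarrow> real \<Rightarrow> real) \<Rightarrow> real \<Rightarrow> real \<Rightarrow>
    ((real \<Rightarrow> real^'n) \<times> (real \<Rightarrow> real^'n)) set" where
  "observed K K' s R = {(x, z). is_solution field {s..} x \<and> (\<forall>t\<ge>s. norm (x t) \<le> \<beta> t R) \<and>
     is_solution (\<lambda>t z. observer K K' t z (x t $ e 1)) {s..} z \<and> z s = 0}"

text \<open>By induction on \<open>i\<close>, the error of the first \<open>i\<close> estimates vanishes with weight \<open>W\<^sub>i\<close>: the \<open>i\<close>-th
  filter then yields the derivative of \<open>x\<^sub>i\<close> with weight \<open>\<Omega>\<close>, and the root yields the next estimate. The
  filter states follow the estimates, hence the states of the system.\<close>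

lemma observed_uniform_convergence:
  assumes B: "weight B B'"
    and H: "\<And>i. i \<in> {1..CARD('n)} \<Longrightarrow> continuous_on ({0..} \<times> UNIV) (\<lambda>(t, x). H i t x)"
    and dH: "\<And>i s t x. i \<in> {1..CARD('n)} \<Longrightarrow> 0 \<le> s \<Longrightarrow> s \<le> t \<Longrightarrow> is_solution field {s..} x \<Longrightarrow>
       ((\<lambda>t. field t (x t) $ e i) has_real_derivative H i t (x t)) (at t within {s..})"
    and majorant: "\<And>i t x x'. i \<in> {1..CARD('n)} \<Longrightarrow> 0 \<le> t \<Longrightarrow>
       norm x \<le> \<beta> t t + 1 \<Longrightarrow> norm x' \<le> \<beta> t t + 1 \<Longrightarrow>
       \<bar>field t x $ e i\<bar> \<le> B t \<and> \<bar>H i t x\<bar> \<le> B t \<and> \<bar>f i t x - f i t x'\<bar> \<le> B t * norm (x - x') \<and>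
       (i < CARD('n) \<longrightarrow> 1 / \<bar>a i t (x $ e 1)\<bar> \<le> B t)"
    and K: "\<And>i. weight (K i) (K' i)" and W: "\<And>i t. 0 \<le> t \<Longrightarrow> 1 \<le> W i t"
    and gain: "\<And>i. i \<in> {1..CARD('n)} \<Longrightarrow> gain_stage B (m i) (W (Suc i)) (K i) (K' i) (W i)"
    and s: "0 \<le> s" and R: "0 \<le> R"
  shows "vanishes (observed K K' s R) (\<lambda>p t. norm (fst p t - snd p t))"
proof -
  define A where "A = observed K K' s R"
  define y where "y p t = fst p t $ e 1" for p :: "(real \<Rightarrow> real^'n) \<times> (real \<Rightarrow> real^'n)" and t
  define est where "est i p t = estimate K i t (snd p t) (y p t)" for i p t
  define err where "err i p t = W i t * norm (est i p t - first_coords i (fst p t))" for i p t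
  define \<xi> where "\<xi> i p t = field t (fst p t) $ e i"
    for i and p :: "(real \<Rightarrow> real^'n) \<times> (real \<Rightarrow> real^'n)" and t
  define V where "V i p t = K i t * (est i p t $ e i - snd p t $ e i) - \<xi> i p t" for i p t
  have sol: "is_solution field {s..} (fst p)" and z0: "snd p s = 0"
    and x_bound: "\<And>t. s \<le> t \<Longrightarrow> norm (fst p t) \<le> \<beta> t R"
    and obs: "is_solution (\<lambda>t z. observer K K' t z (y p t)) {s..} (snd p)" if "p \<in> A" for p
    using that by (auto simp: A_def observed_def y_def)
  have small: "norm (fst p t) \<le> \<beta> t t" if "p \<in> A" "max s R \<le> t" for p t
    using x_bound[OF that(1), of t] \<beta>_mono[of t t R t] that s R by force
  have dx: "((\<lambda>t. fst p t $ e i) has_real_derivative \<xi> i p t) (at t within {s..})"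
    if "p \<in> A" "s \<le> t" for p t i
    unfolding \<xi>_def using solution_nth[OF sol[OF that(1)]] that(2) by simp
  have d\<xi>: "(\<xi> i p has_real_derivative H i t (fst p t)) (at t within {s..})"
    if "i \<in> {1..CARD('n)}" "p \<in> A" "s \<le> t" for i p t
    unfolding \<xi>_def using dH[OF that(1) s that(3) sol[OF that(2)]] .
  have dz: "((\<lambda>t. snd p t $ e i) has_real_derivative
      (K i t + K' i t / K i t) * (est i p t $ e i - snd p t $ e i)) (at t within {s..})"
    if "i \<in> {1..CARD('n)}" "p \<in> A" "s \<le> t" for i p t
    using obs[OF that(2)] that(1,3) unfolding observer_solution_iff est_def by simp
  have lbx: "locally_bounded A s (\<lambda>p t. fst p t)"
    unfolding locally_bounded_def
  proof
    fix T
    have "norm (fst p t) \<le> \<beta> T R" if "p \<in> A" "t \<in> {s..T}" for p t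
      using x_bound[OF that(1), of t] \<beta>_mono[of t T R R] that s R by force
    then show "\<exists>C. \<forall>p\<in>A. \<forall>t\<in>{s..T}. norm (fst p t) \<le> C"
      by blast
  qed
  have lb_nth: "locally_bounded A s (\<lambda>p t. g p t $ k)" if "locally_bounded A s g"
    for g :: "_ \<Rightarrow> real \<Rightarrow> real^'n" and k
    using component_le_norm_cart by (intro locally_bounded_le[OF that]) auto
  have lb\<xi>: "locally_bounded A s (\<xi> i)" if "i \<in> {1..CARD('n)}" for i
    unfolding \<xi>_def by (rule locally_bounded_continuous_image[OF lbx s field_nth_continuous[OF that]])
  have lbH: "locally_bounded A s (\<lambda>p t. H i t (fst p t))" if "i \<in> {1..CARD('n)}" for i
    by (rule locally_bounded_continuous_image[OF lbx s H[OF that]])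
  have lbK: "locally_bounded A s (\<lambda>p t. K i t)" for i
    by (intro locally_bounded_real_function weightD[OF K])
  have inverse_vanishes: "vanishes A (\<lambda>p t. 1 / (1 + t))"
    by (rule vanishes_of_real_function) real_asymp
  \<comment> \<open>The \<open>i\<close>-th filter, given the accuracy of the first \<open>i\<close> estimates.\<close>
  have tracking: "locally_bounded A s (\<lambda>p t. snd p t $ e i) \<and>
      vanishes A (\<lambda>p t. fst p t $ e i - snd p t $ e i) \<and>
      (\<exists>\<Omega>. (\<forall>t\<ge>0. W (Suc i) t ^ m i * B t \<le> \<Omega> t \<and> 0 \<le> \<Omega> t \<and> \<Omega> t * B t \<le> W i t \<and> W (Suc i) t \<le> W i t) \<and>
         vanishes A (\<lambda>p t. \<Omega> t * V i p t))"
    if i: "i \<in> {1..CARD('n)}" and err: "vanishes A (err i)" and lb: "locally_bounded A s (est i)" for i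
  proof -
    from gain[OF i] obtain \<Omega> \<Omega>' where \<Omega>: "weight \<Omega> \<Omega>'" and
      rel: "\<And>t. 0 \<le> t \<Longrightarrow> W (Suc i) t ^ m i * B t \<le> \<Omega> t" "\<And>t. 0 \<le> t \<Longrightarrow> 2 * \<bar>\<Omega>' t\<bar> \<le> K i t"
        "\<And>t. 0 \<le> t \<Longrightarrow> (1 + t) * (\<Omega> t * B t) \<le> K i t"
        "\<And>t. 0 \<le> t \<Longrightarrow> W i t = W (Suc i) t + \<Omega> t * ((K i t)\<^sup>2 + \<bar>K' i t\<bar> + B t)"
      unfolding gain_stage_def by blast
    note Bp = weightD(5)[OF B] and \<Omega>p = weightD(5)[OF \<Omega>] and \<Omega>ge = weightD(4)[OF \<Omega>]
      and Kp = weightD(5)[OF K, of i]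
    have rate: "\<Omega> t * B t / K i t \<le> 1 / (1 + t)" if "0 \<le> t" for t
      using rel(3)[OF that] that Kp[of t] by (simp add: field_simps)
    have est_le: "W i t * \<bar>est i p t $ e i - fst p t $ e i\<bar> \<le> err i p t" if "0 \<le> t" for p t
    proof -
      have "\<bar>(est i p t - first_coords i (fst p t)) $ e i\<bar> \<le> norm (est i p t - first_coords i (fst p t))"
        by (rule component_le_norm_cart)
      then show ?thesis
        using i W[OF that, of i] unfolding err_def by (intro mult_left_mono) (auto simp: first_coords_nth)
    qed
    have \<Omega>W: "\<Omega> t * ((K i t)\<^sup>2 + \<bar>K' i t\<bar>) \<le> W i t" "\<Omega> t * B t \<le> W i t" "W (Suc i) t \<le> W i t"
      if "0 \<le> t" for t
    proof -
      have "0 \<le> \<Omega> t * ((K i t)\<^sup>2 + \<bar>K' i t\<bar>)" "0 \<le> \<Omega> t * B t" "0 \<le> W (Suc i) t"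
        using \<Omega>p[of t] Bp[of t] W[OF that, of "Suc i"] by simp_all
      then show "\<Omega> t * ((K i t)\<^sup>2 + \<bar>K' i t\<bar>) \<le> W i t" "\<Omega> t * B t \<le> W i t" "W (Suc i) t \<le> W i t"
        unfolding rel(4)[OF that] distrib_left[of _ "_ + _" "B t"] by linarith+
    qed
    have HB: "\<bar>\<xi> i p t\<bar> \<le> B t" "\<bar>H i t (fst p t)\<bar> \<le> B t" if "p \<in> A" "max s R \<le> t" for p t
      using majorant[OF i, of t "fst p t" "fst p t"] small[OF that] that s by (auto simp: \<xi>_def)
    have van_H: "vanishes A (\<lambda>p t. \<Omega> t * \<bar>H i t (fst p t)\<bar> / K i t)"
    proof (rule vanishes_le[OF inverse_vanishes])
      fix p t assume p: "p \<in> A" and t: "max s R \<le> t"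
      have "\<bar>\<Omega> t * \<bar>H i t (fst p t)\<bar> / K i t\<bar> = \<Omega> t * \<bar>H i t (fst p t)\<bar> / K i t"
        using \<Omega>p[of t] Kp[of t] by simp
      also have "\<dots> \<le> \<Omega> t * B t / K i t"
        using HB(2)[OF p t] \<Omega>p[of t] Kp[of t] by (intro divide_right_mono mult_left_mono) auto
      also have "\<dots> \<le> 1 / (1 + t)"
        using rate t s by simp
      finally show "\<bar>\<Omega> t * \<bar>H i t (fst p t)\<bar> / K i t\<bar> \<le> 1 / (1 + t)" .
    qed
    have van_est: "vanishes A (\<lambda>p t. \<Omega> t * ((K i t)\<^sup>2 + \<bar>K' i t\<bar>) * \<bar>est i p t $ e i - fst p t $ e i\<bar>)"
    proof (rule vanishes_le[OF err])
      fix p t assume "p \<in> A" and "s \<le> t"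
      then have t: "0 \<le> t" using s by simp
      have "\<Omega> t * ((K i t)\<^sup>2 + \<bar>K' i t\<bar>) * \<bar>est i p t $ e i - fst p t $ e i\<bar>
          \<le> W i t * \<bar>est i p t $ e i - fst p t $ e i\<bar>"
        using \<Omega>W(1)[OF t] by (intro mult_right_mono) auto
      also have "\<dots> \<le> err i p t"
        by (rule est_le[OF t])
      finally show "\<bar>\<Omega> t * ((K i t)\<^sup>2 + \<bar>K' i t\<bar>) * \<bar>est i p t $ e i - fst p t $ e i\<bar>\<bar> \<le> err i p t"
        using \<Omega>p[of t] by simp
    qed
    note high_gain = high_gain_tracking[OF s K[of i] \<Omega>, where A = A and X = "\<lambda>p t. fst p t $ e i" and
          \<xi> = "\<xi> i" and \<eta> = "\<lambda>p t. H i t (fst p t)" and U = "\<lambda>p t. est i p t $ e i" and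
          Z = "\<lambda>p t. snd p t $ e i" and C = 0]
    have *: "locally_bounded A s (\<lambda>p t. snd p t $ e i)" "vanishes A (\<lambda>p t. \<Omega> t * V i p t)"
      unfolding V_def
      by (intro high_gain rel(2) dx d\<xi>[OF i] dz[OF i] lb_nth[OF lbx] lb\<xi>[OF i] lbH[OF i] lb_nth[OF lb]
          van_H van_est; simp add: z0)+
    have "vanishes A (\<lambda>p t. fst p t $ e i - snd p t $ e i)"
    proof (rule vanishes_le[where T = "max s R"])
      show "vanishes A (\<lambda>p t. err i p t + (\<bar>\<Omega> t * V i p t\<bar> + 1 / (1 + t)))"
        by (intro vanishes_add vanishes_abs err * inverse_vanishes)
      fix p t assume p: "p \<in> A" and t: "max s R \<le> t"
      then have t0: "0 \<le> t" using s by simp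
      \<comment> \<open>The filter lags behind its input by \<open>(V + \<xi>) / K\<close>.\<close>
      have eq: "fst p t $ e i - snd p t $ e i = (V i p t + \<xi> i p t) / K i t - (est i p t $ e i - fst p t $ e i)"
        using Kp[of t] by (simp add: V_def)
      have "\<bar>(V i p t + \<xi> i p t) / K i t\<bar> \<le> (\<bar>V i p t\<bar> + \<bar>\<xi> i p t\<bar>) / K i t"
        using divide_right_mono[OF abs_triangle_ineq[of "V i p t" "\<xi> i p t"], of "K i t"] Kp[of t]
        by (simp add: abs_divide)
      then have "\<bar>fst p t $ e i - snd p t $ e i\<bar>
          \<le> \<bar>est i p t $ e i - fst p t $ e i\<bar> + (\<bar>V i p t\<bar> + \<bar>\<xi> i p t\<bar>) / K i t"
        unfolding eq by linarith
      also have "\<bar>est i p t $ e i - fst p t $ e i\<bar> \<le> W i t * \<bar>est i p t $ e i - fst p t $ e i\<bar>"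
        using W[OF t0, of i] by (simp add: mult_le_cancel_right1)
      also have "\<dots> \<le> err i p t"
        by (rule est_le[OF t0])
      also have "(\<bar>V i p t\<bar> + \<bar>\<xi> i p t\<bar>) / K i t \<le> \<bar>\<Omega> t * V i p t\<bar> + 1 / (1 + t)"
      proof -
        have "\<bar>V i p t\<bar> / K i t \<le> \<bar>V i p t\<bar> / 1"
          using weightD(4)[OF K, of i t] by (intro divide_left_mono) auto
        also have "\<dots> \<le> \<bar>\<Omega> t * V i p t\<bar>"
          using \<Omega>ge[of t] by (simp add: abs_mult mult_le_cancel_right1)
        finally have 1: "\<bar>V i p t\<bar> / K i t \<le> \<bar>\<Omega> t * V i p t\<bar>" .
        have "\<bar>\<xi> i p t\<bar> \<le> 1 * B t"
          using HB(1)[OF p t] by simp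
        also have "\<dots> \<le> \<Omega> t * B t"
          using \<Omega>ge[of t] Bp[of t] by (intro mult_right_mono) auto
        finally have "\<bar>\<xi> i p t\<bar> / K i t \<le> \<Omega> t * B t / K i t"
          using Kp[of t] by (intro divide_right_mono) auto
        with 1 rate[OF t0] show ?thesis
          by (simp add: add_divide_distrib)
      qed
      finally show "\<bar>fst p t $ e i - snd p t $ e i\<bar> \<le> err i p t + (\<bar>\<Omega> t * V i p t\<bar> + 1 / (1 + t))"
        by simp
    qed
    then show ?thesis
      using * rel(1) \<Omega>W(2,3) \<Omega>p by (auto intro!: exI[of _ \<Omega>] simp: less_imp_le)
  qed
  have main: "vanishes A (err i) \<and> locally_bounded A s (est i)" if "i \<in> {1..CARD('n)}" for i
  proof -
    have "1 \<le> i" using that by simp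
    then show ?thesis
      using that
    proof (induction i rule: dec_induct)
      case base
      have "est 1 p t = first_coords 1 (fst p t)" for p t
        by (simp add: est_def first_coords_def y_def)
      then have "err 1 = (\<lambda>p t. 0)" "est 1 = (\<lambda>p t. axis (e 1) (fst p t $ e 1))"
        by (auto simp: err_def fun_eq_iff first_coords_def)
      moreover have "locally_bounded A s (\<lambda>p t. axis (e 1) (fst p t $ e 1))"
        using component_le_norm_cart by (intro locally_bounded_le[OF lbx]) (simp add: norm_axis_real)
      ultimately show ?case
        by (simp add: vanishes_iff gt_ex)
    next
      case (step i)
      then have i: "i \<in> {1..CARD('n)}" "i \<in> {1..<CARD('n)}" and i0: "i \<noteq> 0" and lt: "i < CARD('n)"
        by auto
      have IH: "vanishes A (err i)" "locally_bounded A s (est i)"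
        using step.IH i(1) by auto
      note m = m_odd[OF i(2)] and mp = odd_pos[OF m_odd[OF i(2)]]
      from tracking[OF i(1) IH] obtain \<Omega> where lbz: "locally_bounded A s (\<lambda>p t. snd p t $ e i)"
        and \<Omega>: "\<And>t. 0 \<le> t \<Longrightarrow> W (Suc i) t ^ m i * B t \<le> \<Omega> t" "\<And>t. 0 \<le> t \<Longrightarrow> 0 \<le> \<Omega> t"
          "\<And>t. 0 \<le> t \<Longrightarrow> \<Omega> t * B t \<le> W i t" "\<And>t. 0 \<le> t \<Longrightarrow> W (Suc i) t \<le> W i t"
        and vV: "vanishes A (\<lambda>p t. \<Omega> t * V i p t)"
        by blast
      \<comment> \<open>The radicand for the next estimate; the exact radicand is the one in \<open>x_root\<close> below.\<close>
      define q where "q p t = (K i t * (est i p t $ e i - snd p t $ e i) - f i t (est i p t)) / a i t (y p t)" for p t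
      define d where "d p t = norm (est i p t - first_coords i (fst p t))" for p t
      have est_Suc: "est (Suc i) p t = est i p t + axis (e (Suc i)) (root (m i) (q p t))" for p t
        using i0 by (simp add: est_def q_def)
      have fc_Suc: "first_coords (Suc i) v = first_coords i v + axis (e (Suc i)) (v $ e (Suc i))" for v
        by (simp add: first_coords_def)
      have x_root: "fst p t $ e (Suc i) = root (m i) ((\<xi> i p t - f i t (first_coords i (fst p t))) / a i t (y p t))"
        if "0 \<le> t" for p t
        using a_nz[OF i(2) that] m f_first_coords[OF i(1) that] lt
        by (simp add: \<xi>_def field_nth[OF i(1)] y_def odd_real_root_power_cancel)
      have q_err: "\<bar>q p t - (\<xi> i p t - f i t (first_coords i (fst p t))) / a i t (y p t)\<bar> \<le> B t * (\<bar>V i p t\<bar> + B t * d p t)"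
        if p: "p \<in> A" and t: "max s R \<le> t" and d1: "d p t \<le> 1" for p t
      proof -
        have t0: "0 \<le> t" using t s by simp
        have fx: "norm (first_coords i (fst p t)) \<le> \<beta> t t"
          using norm_first_coords_le[of i "fst p t"] small[OF p t] lt by simp
        have "norm (est i p t) \<le> \<beta> t t + 1"
          using norm_triangle_sub[of "est i p t" "first_coords i (fst p t)"] fx d1 by (simp add: d_def)
        then have f_le: "\<bar>f i t (est i p t) - f i t (first_coords i (fst p t))\<bar> \<le> B t * d p t"
          using majorant[OF i(1) t0, of "est i p t" "first_coords i (fst p t)"] fx by (simp add: d_def)
        have a_le: "1 / \<bar>a i t (y p t)\<bar> \<le> B t"
          using majorant[OF i(1) t0, of "fst p t" "fst p t"] small[OF p t] lt by (simp add: y_def)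
        have "q p t - (\<xi> i p t - f i t (first_coords i (fst p t))) / a i t (y p t) =
            (V i p t - (f i t (est i p t) - f i t (first_coords i (fst p t)))) / a i t (y p t)"
          by (simp add: q_def V_def diff_divide_distrib)
        then have "\<bar>q p t - (\<xi> i p t - f i t (first_coords i (fst p t))) / a i t (y p t)\<bar> =
            1 / \<bar>a i t (y p t)\<bar> * \<bar>V i p t - (f i t (est i p t) - f i t (first_coords i (fst p t)))\<bar>"
          by (simp add: abs_divide)
        also have "\<dots> \<le> B t * (\<bar>V i p t\<bar> + B t * d p t)"
          using a_le f_le abs_triangle_ineq4[of "V i p t" "f i t (est i p t) - f i t (first_coords i (fst p t))"]
            weightD(5)[OF B, of t] by (intro mult_mono) auto
        finally show ?thesis .
      qed
      have "vanishes A d"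
      proof (rule vanishes_le[OF IH(1)])
        fix p t assume "p \<in> A" "s \<le> t"
        then show "\<bar>d p t\<bar> \<le> err i p t"
          using W[of t i] s by (simp add: d_def err_def mult_le_cancel_right1)
      qed
      \<comment> \<open>From time \<open>T\<close> on, the estimates lie in the ball where the bounds by \<open>B\<close> hold.\<close>
      then obtain T where T: "\<And>p t. p \<in> A \<Longrightarrow> T \<le> t \<Longrightarrow> d p t \<le> 1"
        unfolding vanishes_iff by (metis abs_less_iff less_eq_real_def zero_less_one)
      have "vanishes A (err (Suc i))"
      proof (rule vanishes_le[where T = "max T (max s R)"])
        show "vanishes A (\<lambda>p t. err i p t + 2 * root (m i) (\<bar>\<Omega> t * V i p t\<bar> + err i p t))"
          by (intro vanishes_add vanishes_cmult vanishes_root vanishes_abs vV IH mp)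
        fix p t assume p: "p \<in> A" and "max T (max s R) \<le> t"
        then have t: "max s R \<le> t" "0 \<le> t" and d1: "d p t \<le> 1"
          using T s by auto
        note Wt = W[OF t(2), of "Suc i"]
        define r where "r = \<bar>q p t - (\<xi> i p t - f i t (first_coords i (fst p t))) / a i t (y p t)\<bar>"
        have "W (Suc i) t ^ m i * r \<le> W (Suc i) t ^ m i * (B t * (\<bar>V i p t\<bar> + B t * d p t))"
          unfolding r_def using Wt by (intro mult_left_mono q_err p t d1) auto
        also have "\<dots> = W (Suc i) t ^ m i * B t * (\<bar>V i p t\<bar> + B t * d p t)"
          by simp
        also have "\<dots> \<le> \<Omega> t * (\<bar>V i p t\<bar> + B t * d p t)"
          using \<Omega>(1)[OF t(2)] weightD(5)[OF B, of t] by (intro mult_right_mono) (auto simp: d_def)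
        also have "\<dots> = \<bar>\<Omega> t * V i p t\<bar> + \<Omega> t * B t * d p t"
          using \<Omega>(2)[OF t(2)] by (simp add: abs_mult distrib_left)
        also have "\<dots> \<le> \<bar>\<Omega> t * V i p t\<bar> + err i p t"
          unfolding err_def using \<Omega>(3)[OF t(2)] by (simp add: d_def mult_right_mono)
        finally have r_le: "W (Suc i) t ^ m i * r \<le> \<bar>\<Omega> t * V i p t\<bar> + err i p t" .
        have "norm (est (Suc i) p t - first_coords (Suc i) (fst p t)) \<le>
            d p t + \<bar>root (m i) (q p t) - fst p t $ e (Suc i)\<bar>"
        proof -
          have "est (Suc i) p t - first_coords (Suc i) (fst p t) = (est i p t - first_coords i (fst p t)) +
              axis (e (Suc i)) (root (m i) (q p t) - fst p t $ e (Suc i))"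
            unfolding est_Suc fc_Suc by (simp add: vec_eq_iff axis_def)
          then show ?thesis
            unfolding d_def by (metis norm_triangle_ineq norm_axis_real)
        qed
        also have "\<bar>root (m i) (q p t) - fst p t $ e (Suc i)\<bar> \<le> 2 * root (m i) r"
          unfolding x_root[OF t(2)] r_def by (rule odd_root_hoelder[OF m])
        finally have "err (Suc i) p t \<le> W (Suc i) t * (d p t + 2 * root (m i) r)"
          unfolding err_def using Wt by (intro mult_left_mono) auto
        also have "\<dots> = W (Suc i) t * d p t + 2 * root (m i) (W (Suc i) t ^ m i * r)"
          using Wt mp by (simp add: real_root_mult real_root_power_cancel distrib_left)
        also have "\<dots> \<le> err i p t + 2 * root (m i) (\<bar>\<Omega> t * V i p t\<bar> + err i p t)"
          unfolding err_def[of i p t, folded d_def] using \<Omega>(4)[OF t(2)] r_le mp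
          by (intro add_mono mult_right_mono mult_left_mono) (auto simp: d_def err_def)
        finally show "\<bar>err (Suc i) p t\<bar> \<le> err i p t + 2 * root (m i) (\<bar>\<Omega> t * V i p t\<bar> + err i p t)"
          using Wt by (simp add: err_def)
      qed
      moreover have "locally_bounded A s (est (Suc i))"
      proof -
        have cinv: "continuous_on ({0..} \<times> UNIV) (\<lambda>(t, v). 1 / a i t v)"
          unfolding case_prod_beta using a_nz[OF i(2)]
          by (intro continuous_intros a_continuous_compose[OF i(2)]) auto
        have croot: "continuous_on ({0..} \<times> UNIV) (\<lambda>(t::real, v). root (m i) v)"
          unfolding case_prod_beta by (intro continuous_intros)
        have "locally_bounded A s (\<lambda>p t. (K i t * (est i p t $ e i - snd p t $ e i) - f i t (est i p t)) * (1 / a i t (y p t)))"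
          unfolding y_def
          by (intro locally_bounded_mult locally_bounded_diff lbK lb_nth IH lbz
              locally_bounded_continuous_image[OF _ s f_continuous[OF i(1)]]
              locally_bounded_continuous_image[OF _ s cinv] lbx)
        then have "locally_bounded A s q"
          by (simp add: locally_bounded_def q_def)
        then have "locally_bounded A s (\<lambda>p t. root (m i) (q p t))"
          by (rule locally_bounded_continuous_image[OF _ s croot])
        then have "locally_bounded A s (\<lambda>p t. axis (e (Suc i)) (root (m i) (q p t)))"
          by (rule locally_bounded_le) (simp add: norm_axis_real)
        with IH(2) have "locally_bounded A s (\<lambda>p t. est i p t + axis (e (Suc i)) (root (m i) (q p t)))"
          by (rule locally_bounded_add)
        then show ?thesis
          by (simp add: locally_bounded_def est_Suc)
      qed
      ultimately show ?case
        by blast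
    qed
  qed
  have "vanishes A (\<lambda>p t. \<Sum>i=1..CARD('n). \<bar>fst p t $ e i - snd p t $ e i\<bar>)"
    using tracking main by (intro vanishes_sum vanishes_abs) blast
  then have "vanishes A (\<lambda>p t. norm (fst p t - snd p t))"
  proof (rule vanishes_le)
    fix p :: "(real \<Rightarrow> real^'n) \<times> (real \<Rightarrow> real^'n)" and t
    have "norm (fst p t - snd p t) \<le> (\<Sum>k\<in>UNIV. \<bar>(fst p t - snd p t) $ k\<bar>)"
      by (rule norm_le_l1_cart)
    also have "\<dots> = (\<Sum>i=1..CARD('n). \<bar>(fst p t - snd p t) $ e i\<bar>)"
      by (rule sum.reindex_bij_betw[OF e, symmetric])
    finally show "\<bar>norm (fst p t - snd p t)\<bar> \<le> (\<Sum>i=1..CARD('n). \<bar>fst p t $ e i - snd p t $ e i\<bar>)"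
      by simp
  qed
  then show ?thesis
    by (simp add: A_def)
qed

section \<open>Solution of the observer design problems\<close>

lemma uniformly_convergent_observer:
  obtains K K' where "\<And>i. weight (K i) (K' i)"
    "\<And>s R. 0 \<le> s \<Longrightarrow> 0 \<le> R \<Longrightarrow> vanishes (observed K K' s R) (\<lambda>p t. norm (fst p t - snd p t))"
proof -
  obtain H B B' where B: "weight B B'"
    and H: "\<And>i. i \<in> {1..CARD('n)} \<Longrightarrow> continuous_on ({0..} \<times> UNIV) (\<lambda>(t, x). H i t x)"
      "\<And>i s t x. i \<in> {1..CARD('n)} \<Longrightarrow> 0 \<le> s \<Longrightarrow> s \<le> t \<Longrightarrow> is_solution field {s..} x \<Longrightarrow>
       ((\<lambda>t. field t (x t) $ e i) has_real_derivative H i t (x t)) (at t within {s..})"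
    and majorant: "\<And>i t x x'. i \<in> {1..CARD('n)} \<Longrightarrow> 0 \<le> t \<Longrightarrow>
       norm x \<le> \<beta> t t + 1 \<Longrightarrow> norm x' \<le> \<beta> t t + 1 \<Longrightarrow>
       \<bar>field t x $ e i\<bar> \<le> B t \<and> \<bar>H i t x\<bar> \<le> B t \<and> \<bar>f i t x - f i t x'\<bar> \<le> B t * norm (x - x') \<and>
       (i < CARD('n) \<longrightarrow> 1 / \<bar>a i t (x $ e 1)\<bar> \<le> B t)"
    by (rule system_majorant) (rule that)
  obtain K K' W where K: "\<And>i. weight (K i) (K' i)" "\<And>i t. 0 \<le> t \<Longrightarrow> 1 \<le> W i t"
    "\<And>i. i \<in> {1..CARD('n)} \<Longrightarrow> gain_stage B (m i) (W (Suc i)) (K i) (K' i) (W i)"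
    by (rule gain_sequence[OF B]) (rule that)
  show thesis
    by (rule that[OF K(1)]) (rule observed_uniform_convergence[OF B H majorant K])
qed


lemma output_continuous: "is_solution field {s..} x \<Longrightarrow> continuous_on {s..} (\<lambda>t. x t $ k)"
  using solution_nth by (intro DERIV_continuous_on) blast

lemma in_observed:
  assumes "0 \<le> t0" "t0 \<le> s" "is_solution field {t0..} x" "norm (x t0) \<le> R"
    and "is_solution (\<lambda>t z. observer K K' t z (x t $ e 1)) {s..} z" "z s = 0"
  shows "(x, z) \<in> observed K K' s R"
proof -
  have "is_solution field {s..} x"
    using assms(2,3) by (auto intro: is_solution_subset)
  moreover have "norm (x t) \<le> \<beta> t R" if "s \<le> t" for t
    using bound[OF assms(1,3), of t] \<beta>_mono[of t t "norm (x t0)" R] assms that by force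
  ultimately show ?thesis
    using assms by (simp add: observed_def)
qed

theorem ODP_solvable_triangular: "ODP_solvable field (\<lambda>t x. x $ e 1) M"
proof -
  obtain K K' where K: "\<And>i. weight (K i) (K' i)" and
    conv: "\<And>s R. 0 \<le> s \<Longrightarrow> 0 \<le> R \<Longrightarrow> vanishes (observed K K' s R) (\<lambda>p t. norm (fst p t - snd p t))"
    by (rule uniformly_convergent_observer) (rule that)
  show ?thesis
    unfolding ODP_solvable_def
  proof (intro allI impI exI[of _ "observer K K'"] exI[of _ "{0}"] conjI ballI)
    fix t0 :: real assume t0: "0 \<le> t0"
    show "continuous_on ({t0..} \<times> UNIV \<times> UNIV) (\<lambda>(t, z, w). observer K K' t z w)"
      using t0 by (intro continuous_on_subset[OF observer_continuous[OF K]]) auto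
    fix z0 :: "real^'n" and x assume z0: "z0 \<in> {0}" and "is_solution field {t0..} x \<and> x t0 \<in> M"
    then have x: "is_solution field {t0..} x"
      by simp
    show "solution_exists_on (\<lambda>t z. observer K K' t z (x t $ e 1)) {t0..} t0 z0"
      using z0 observer_solution_exists_on[OF K t0 output_continuous[OF x]] by simp
    fix z assume "is_solution (\<lambda>t z. observer K K' t z (x t $ e 1)) {t0..} z \<and> z t0 = z0"
    then have p: "(x, z) \<in> observed K K' t0 (norm (x t0))"
      using z0 by (intro in_observed[OF t0 order_refl x]) auto
    have "((\<lambda>t. norm (x t - z t)) \<longlongrightarrow> 0) at_top"
      using conv[OF t0 norm_ge_zero[of "x t0"]] p
      unfolding vanishes_iff tendsto_iff eventually_at_top_linorder by fastforce
    then show "((\<lambda>t. x t - z t) \<longlongrightarrow> 0) at_top"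
      by (rule tendsto_norm_zero_cancel)
  qed simp
qed

theorem SODP_solvable_triangular: "SODP_solvable field (\<lambda>t x. x $ e 1) M"
  unfolding SODP_solvable_def
proof (intro allI impI)
  fix t0 :: real assume t0: "0 \<le> t0"
  obtain K K' where K: "\<And>i. weight (K i) (K' i)" and
    conv: "\<And>s R. 0 \<le> s \<Longrightarrow> 0 \<le> R \<Longrightarrow> vanishes (observed K K' s R) (\<lambda>p t. norm (fst p t - snd p t))"
    by (rule uniformly_convergent_observer) (rule that)
  have "\<exists>T. \<forall>p\<in>observed K K' s (real k). \<forall>t\<ge>T. norm (fst p t - snd p t) < 1 / real k"
    if "0 \<le> s" "0 < k" for s k
    using conv[OF that(1), of "real k"] that(2) unfolding vanishes_iff by simp
  \<comment> \<open>\<open>\<theta> s k\<close> is a time from which on the observer started at time \<open>s\<close> has error below \<open>1/k\<close>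
    for all trajectories bounded by \<open>\<beta>(\<cdot>, k)\<close>.\<close>
  then obtain \<theta> where \<theta>: "\<And>s k p t. 0 \<le> s \<Longrightarrow> 0 < k \<Longrightarrow> p \<in> observed K K' s (real k) \<Longrightarrow> \<theta> s k \<le> t \<Longrightarrow>
      norm (fst p t - snd p t) < 1 / real k"
    by metis
  \<comment> \<open>The copy used on \<open>[\<tau> k, \<tau> (k + 1))\<close> starts at \<open>\<tau> (k - 1)\<close>, so \<open>\<tau> k\<close> has to exceed \<open>\<theta> (\<tau> (k - 1)) k\<close>
    for \<open>k \<ge> 2\<close>; the first copy starts at \<open>\<tau> 0 = \<tau> 1\<close> and has no time to converge.\<close>
  define \<tau> where "\<tau> = rec_nat t0 (\<lambda>j s. if j = 0 then t0 else max (s + 1) (\<theta> s (Suc j)))"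
  have \<tau>0: "\<tau> 0 = t0" "\<tau> 1 = t0"
    by (simp_all add: \<tau>_def)
  have \<tau>_Suc: "\<tau> (Suc j) = max (\<tau> j + 1) (\<theta> (\<tau> j) (Suc j))" if "1 \<le> j" for j
    using that by (simp add: \<tau>_def)
  have step: "\<tau> j \<le> \<tau> (Suc j)" for j
    using \<tau>0 \<tau>_Suc[of j] by (cases "j = 0") auto
  have mono: "\<tau> i \<le> \<tau> j" if "i \<le> j" for i j
    using step that by (rule lift_Suc_mono_le)
  have \<tau>_ge: "t0 \<le> \<tau> j" for j
    using mono[of 0 j] \<tau>0 by simp
  have \<tau>_large: "real j - 1 \<le> \<tau> j" if "1 \<le> j" for j
    using that
  proof (induction j rule: dec_induct)
    case base
    then show ?case using t0 \<tau>0 by simp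
  next
    case (step j)
    then show ?case using \<tau>_Suc[of j] by simp
  qed
  have \<tau>_top: "filterlim \<tau> at_top sequentially"
  proof (rule filterlim_at_top_mono)
    show "filterlim (\<lambda>j. real j - 1) at_top sequentially"
      by real_asymp
    show "eventually (\<lambda>j. real j - 1 \<le> \<tau> j) sequentially"
      using \<tau>_large eventually_ge_at_top[of 1] by (rule eventually_mono[rotated])
  qed
  have \<tau>_strict: "strict_mono_on {1..} \<tau>"
  proof (rule strict_mono_onI)
    fix i j :: nat assume "i \<in> {1..}" "i < j"
    then have "\<tau> i < \<tau> (Suc i)" "\<tau> (Suc i) \<le> \<tau> j"
      using \<tau>_Suc[of i] mono[of "Suc i" j] by auto
    then show "\<tau> i < \<tau> j"
      by simp
  qed
  show "\<exists>\<tau> G Mbar. \<tau> 0 = t0 \<and> \<tau> 1 = t0 \<and> strict_mono_on {1..} \<tau> \<and> filterlim \<tau> at_top sequentially \<and>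
      (\<forall>k\<ge>1. continuous_on ({\<tau> (k - 1)..\<tau> (k + 1)} \<times> UNIV \<times> UNIV) (\<lambda>(t, z, w). G k t z w)) \<and>
      Mbar \<noteq> {} \<and>
      (\<forall>x. is_solution field {t0..} x \<and> x t0 \<in> M \<longrightarrow>
         (\<forall>k\<ge>1. \<forall>z0\<in>Mbar.
            solution_exists_on (\<lambda>t z. G k t z (x t $ e 1)) {\<tau> (k - 1)..\<tau> (k + 1)} (\<tau> (k - 1)) z0) \<and>
         (\<forall>z Z.
            (\<forall>k\<ge>1. is_solution (\<lambda>t z. G k t z (x t $ e 1)) {\<tau> (k - 1)..\<tau> (k + 1)} (z k) \<and>
               z k (\<tau> (k - 1)) \<in> Mbar) \<and>
            (\<forall>k\<ge>1. \<forall>t\<in>{\<tau> k..<\<tau> (k + 1)}. Z t = z k t) \<longrightarrow>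
            ((\<lambda>t. x t - Z t) \<longlongrightarrow> 0) at_top))"
  proof (rule exI[of _ \<tau>], rule exI[of _ "\<lambda>_. observer K K'"], rule exI[of _ "{0}"],
      intro conjI \<tau>0 \<tau>_strict \<tau>_top allI impI ballI)
    fix k :: nat assume "1 \<le> k"
    show "continuous_on ({\<tau> (k - 1)..\<tau> (k + 1)} \<times> UNIV \<times> UNIV) (\<lambda>(t, z, w). observer K K' t z w)"
      using t0 \<tau>_ge[of "k - 1"] by (intro continuous_on_subset[OF observer_continuous[OF K]]) auto
  next
    fix x and k :: nat and z0 :: "real^'n"
    assume "is_solution field {t0..} x \<and> x t0 \<in> M" and z0: "z0 \<in> {0}"
    then have "continuous_on {\<tau> (k - 1)..} (\<lambda>t. x t $ e 1)"
      using output_continuous \<tau>_ge[of "k - 1"] by (auto intro: continuous_on_subset)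
    then show "solution_exists_on (\<lambda>t z. observer K K' t z (x t $ e 1)) {\<tau> (k - 1)..\<tau> (k + 1)} (\<tau> (k - 1)) z0"
      using z0 t0 \<tau>_ge[of "k - 1"] by (auto intro!: observer_solution_exists_on[OF K])
  next
    fix x z Z
    assume "is_solution field {t0..} x \<and> x t0 \<in> M" and
      zZ: "(\<forall>k\<ge>1. is_solution (\<lambda>t z. observer K K' t z (x t $ e 1)) {\<tau> (k - 1)..\<tau> (k + 1)} (z k) \<and>
         z k (\<tau> (k - 1)) \<in> {0}) \<and> (\<forall>k\<ge>1. \<forall>t\<in>{\<tau> k..<\<tau> (k + 1)}. Z t = z k t)"
    then have x: "is_solution field {t0..} x"
      by simp
    have close: "norm (x t - Z t) < 1 / real k"
      if k: "2 \<le> k" "norm (x t0) \<le> real k" and t: "t \<in> {\<tau> k..<\<tau> (k + 1)}" for k t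
    proof -
      define s where "s = \<tau> (k - 1)"
      have s: "0 \<le> s" "t0 \<le> s"
        using \<tau>_ge[of "k - 1"] t0 by (simp_all add: s_def)
      have k1: "1 \<le> k - 1" "Suc (k - 1) = k"
        using k by simp_all
      have \<tau>k: "s \<le> \<tau> k" "\<theta> s k \<le> \<tau> k"
        using \<tau>_Suc[OF k1(1)] unfolding k1(2) s_def by simp_all
      have y: "continuous_on {s..} (\<lambda>t. x t $ e 1)"
        using output_continuous[OF x] s by (auto intro: continuous_on_subset)
      \<comment> \<open>The given solution is known on a bounded interval only; by uniqueness it is part of a global one.\<close>
      obtain \<zeta> where \<zeta>: "is_solution (\<lambda>t z. observer K K' t z (x t $ e 1)) {s..} \<zeta>" "\<zeta> s = 0"
        by (rule observer_solution[OF K s(1) y]) (rule that)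
      have zk: "is_solution (\<lambda>t z. observer K K' t z (x t $ e 1)) {s..\<tau> (k + 1)} (z k)" "z k s = 0"
        "Z t = z k t"
        using zZ k t by (auto simp: s_def)
      have "\<zeta> t = z k t"
      proof (rule observer_unique[OF K, where J = "{s..\<tau> (k + 1)}" and s = s and y = "\<lambda>t. x t $ e 1"])
        show "is_solution (\<lambda>t z. observer K K' t z (x t $ e 1)) {s..\<tau> (k + 1)} \<zeta>"
          using \<zeta>(1) by (rule is_solution_subset) auto
      qed (use zk \<zeta> t \<tau>k in auto)
      moreover have "(x, \<zeta>) \<in> observed K K' s (real k)"
        by (rule in_observed[OF t0 s(2) x k(2) \<zeta>])
      ultimately show ?thesis
        using \<theta>[OF s(1), of k "(x, \<zeta>)" t] \<tau>k t k zk(3) by auto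
    qed
    show "((\<lambda>t. x t - Z t) \<longlongrightarrow> 0) at_top"
      unfolding tendsto_iff eventually_at_top_linorder dist_norm
    proof (intro allI impI)
      fix \<epsilon> :: real assume "0 < \<epsilon>"
      obtain N where N: "max (norm (x t0)) (1 / \<epsilon>) < real N"
        using reals_Archimedean2 by blast
      define k0 where "k0 = max 2 N"
      have "norm (x t - Z t - 0) < \<epsilon>" if t: "\<tau> k0 \<le> t" for t
      proof -
        have "eventually (\<lambda>j. t < \<tau> j) sequentially"
          using \<tau>_top unfolding filterlim_at_top_dense by blast
        then obtain j where j: "t < \<tau> j"
          using eventually_happens'[OF sequentially_bot] by blast
        \<comment> \<open>\<open>t\<close> lies in the switching interval that ends at \<open>\<tau> l\<close>.\<close>
        define l where "l = (LEAST j. t < \<tau> j)"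
        have l: "t < \<tau> l"
          unfolding l_def using j by (rule LeastI)
        have l_min: "\<tau> j \<le> t" if "j < l" for j
          using not_less_Least[OF that[unfolded l_def]] by simp
        have "k0 < l"
        proof (rule ccontr)
          assume "\<not> k0 < l"
          then have "\<tau> l \<le> \<tau> k0"
            by (intro mono) simp
          with l t show False
            by simp
        qed
        define k where "k = l - 1"
        have k: "l = k + 1" "k0 \<le> k" "\<tau> k \<le> t"
          using \<open>k0 < l\<close> l_min[of "l - 1"] by (auto simp: k_def)
        have "real N \<le> real k"
          using k(2) by (simp add: k0_def)
        then have "norm (x t - Z t) < 1 / real k"
          using close[of k t] k l N by (auto simp: k0_def)
        also have "\<dots> \<le> \<epsilon>"
        proof -
          have "1 / \<epsilon> \<le> real k" "0 < real k"
            using N \<open>real N \<le> real k\<close> k(2) by (auto simp: k0_def)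
          then show ?thesis
            using \<open>0 < \<epsilon>\<close> by (simp add: field_simps)
        qed
        finally show ?thesis by simp
      qed
      then show "\<exists>T. \<forall>t\<ge>T. norm (x t - Z t - 0) < \<epsilon>"
        by blast
    qed
  qed auto
qed

end

theorem theorem1p1:
  fixes e :: "nat \<Rightarrow> 'n::finite"
    and f :: "nat \<Rightarrow> real \<Rightarrow> real^'n \<Rightarrow> real"
    and a :: "nat \<Rightarrow> real \<Rightarrow> real \<Rightarrow> real"
    and m :: "nat \<Rightarrow> nat"
    and \<beta> :: "real \<Rightarrow> real \<Rightarrow> real"
  assumes e: "bij_betw e {1..CARD('n)} UNIV"
    and m_odd: "\<And>i. i \<in> {1..<CARD('n)} \<Longrightarrow> odd (m i)"
    and f_dep: "\<And>i. i \<in> {1..CARD('n)} \<Longrightarrow> depends_on_first e i (f i)"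
    and f_C1: "\<And>i. i \<in> {1..CARD('n)} \<Longrightarrow> C1_on ({0..} \<times> UNIV) (\<lambda>(t, x). f i t x)"
    and a_C1: "\<And>i. i \<in> {1..<CARD('n)} \<Longrightarrow> C1_on ({0..} \<times> UNIV) (\<lambda>(t, y). a i t y)"
    and complete: "forward_complete (triangular_field e f a m)"
    and \<beta>: "class_NN \<beta>"
    and bound: "\<And>t0 x t. 0 \<le> t0 \<Longrightarrow> is_solution (triangular_field e f a m) {t0..} x \<Longrightarrow> t0 \<le> t \<Longrightarrow>
                  norm (x t) \<le> \<beta> t (norm (x t0))"
    and a_nz: "\<And>i t y. i \<in> {1..<CARD('n)} \<Longrightarrow> 0 \<le> t \<Longrightarrow> \<bar>a i t y\<bar> > 0"
  shows "SODP_solvable (triangular_field e f a m) (\<lambda>t x. x $ e 1) UNIV \<and>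
         (\<forall>R>0. ODP_solvable (triangular_field e f a m) (\<lambda>t x. x $ e 1) (cball 0 R))"
proof -
  interpret bounded_triangular_system e f a m \<beta>
  proof unfold_locales
    fix t t' r r' :: real assume *: "0 \<le> t" "t \<le> t'" "0 \<le> r" "r \<le> r'"
    have "\<beta> t r \<le> \<beta> t' r"
      using \<beta> * unfolding class_NN_def class_N_def by (auto intro: mono_onD)
    also have "mono_on {0..} (\<beta> t')"
      using \<beta> * unfolding class_NN_def class_N_def by auto
    then have "\<beta> t' r \<le> \<beta> t' r'"
      using * by (intro mono_onD[of "{0..}" "\<beta> t'"]) auto
    finally show "\<beta> t r \<le> \<beta> t' r'" .
  qed (use e m_odd f_dep f_C1 a_C1 bound a_nz in \<open>simp_all add: zero_less_abs_iff\<close>)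
  show ?thesis
    using SODP_solvable_triangular ODP_solvable_triangular by blast
qed

end
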